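(* Let $A$ be a unital $A_\infty$-algebra with unit $I$ and a unital strong homotopy inner product $\phi:A\to A^*$, and let $$\Psi(x)=\sum_{p,q\ge0}\frac1{p+q+1}\big\langle x^{\otimes p}\otimes\underline{x}\otimes x^{\otimes q}\,\big|\,I\big\rangle_{p,q}.$$ Then $\Psi$ restricted to the set $MC(A)$ of Maurer–Cartan elements is invariant under gauge equivalence; i.e. if $x(t)\in A^1[t]$ is a one-parameter family of Maurer–Cartan elements for which there is $c(t)\in A^0[t]$ with $\frac{d}{dt}x(t)=\sum_{k\ge1}m_k(x(t),\dots,x(t),c(t),x(t),\dots,x(t))$ (sum over all $k\ge 1$ and all positions of $c(t)$), then $$\frac{d}{dt}\Psi(x(t))=0.$$
   Context: Conventions. $\boldsymbol{k}$ is a field of characteristic $0$; $|x|'=|x|-1$ is the shifted degree. An $A_\infty$-algebra $(A,\{m_k\}_{k\ge1})$ is a graded vector space with multilinear maps $m_k:A^{\otimes k}\to A$ of degree $1$ for the shifted degree with $\sum_{i,j}(-1)^{|x_1|'+\cdots+|x_i|'}m_{n-j+1}(x_1,\dots,x_i,m_j(x_{i+1},\dots,x_{i+j}),\dots,x_n)=0$ for all $n\ge1$. $H^\bullet(A)$ is the cohomology of $m_1$ (assumed finite dimensional). A unit is an element $I\in A^0$ with $m_2(I,x)=(-1)^{\deg x}m_2(x,I)=x$ for all $x$ and $m_k(\dots,I,\dots)=0$ for $k\ne2$. Bimodule maps $A\to A^*$. An $A_\infty$-bimodule map $\phi:A\to A^*$ is a family $\phi_{p,q}:A^{\otimes p}\otimes\underline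 A\otimes A^{\otimes q}\to A^*$, $p,q\ge0$ (the underline marks the bimodule entry), such that for all $a_1,\dots,a_p,v,b_1,\dots,b_q,w\in A$ the following sum is $0$: the sum of all terms obtained by applying some $m_j$ to a consecutive string in $(a_1,\dots,a_p,v,b_1,\dots,b_q)$ (with sign $(-1)$ to the sum of the shifted degrees of the entries to the left of the string; the output is the new bimodule entry if the string contains $v$) and evaluating $\phi(\cdots)(w)$, plus $\sum_{0\le i\le p,\,0\le j\le q}(-1)^{\epsilon}\phi(a_{i+1},\dots,a_p,\underline v,b_1,\dots,b_j)\big(m(b_{j+1},\dots,b_q,w,a_1,\dots,a_i)\big)$, where $\epsilon=(\sum_{s\le i}|a_s|')(\sum_{s>i}|a_s|'+|v|'+\sum_s|b_s|'+|w|')+\sum_{s>i}|a_s|'+|v|'+\sum_{s\le j}|b_s|'$. Write $\langle x_1,\dots,x_p,\underline v,y_1,\dots,y_q\,|\,w\rangle_{p,q}=\phi_{p,q}(x_1,\dots,x_p,\underline v,y_1,\dots,y_q)(w)$. The map $\phi$ is unital if $\phi_{k,l}(\vec a,\underline v,\vec b)(w)=0$ whenever one of the $a_i$ or $b_j$ is a constant multiple of $I$. Strong homotopy inner product. This is an $A_\infty$-bimodule map $\phi:A\to A^*$ such that: (1) (skew symmetry) $\phi_{k,l}(\vec a,\underline v,\vec b)(w)=-(-1)^{K}\phi_{l,k}(\vec b,\underline w,\vec a)(v)$, $K=(\sum_{i=1}^k|a_i|'+|v|')(\sum_{j=1}^l|b_j|'+|w|')$; (2) (closedness) for every family $(a_1,\dots,a_n)$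 and $1\le i<j<k\le n$, $[i,j]+[j,k]+[k,i]=0$, where for $r\ne s$ one puts $[r,s]=(-1)^{K_s}\phi(\dots,\underline{a_r},\dots)(a_s)$, the entries $(\dots,\underline{a_r},\dots;a_s)$ being the cyclic rotation $(a_{s+1},\dots,a_n,a_1,\dots,a_s)$ of the family and $K_s=(|a_1|'+\cdots+|a_s|')(|a_{s+1}|'+\cdots+|a_n|')$ the Koszul exponent of that rotation; (3) (homological non-degeneracy) for every nonzero $[a]\in H^\bullet(A)$ there is $[b]\in H^\bullet(A)$ with $\phi_{0,0}(a)(b)\ne0$. Maurer–Cartan elements. $b\in A^1$ is a Maurer–Cartan element if $\sum_{k\ge1}m_k(b,\dots,b)=0$; $MC(A)$ is the set of these. Two elements $b,\widetilde b\in MC(A)$ are gauge equivalent if there are $b(t)\in A^1[t]$, $c(t)\in A^0[t]$ with $b(0)=b$, $b(1)=\widetilde b$ and $\frac{d}{dt}b(t)=\sum_{k\ge1}m_k(b(t),\dots,b(t),c(t),b(t),\dots,b(t))$ (sum over all positions of $c(t)$); it is known that then $b(t)$ is a Maurer–Cartan element for every $t$. Convention on infinite sums. All infinite sums occurring (the Maurer–Cartan equation, the gauge equation, $\Psi$ and the sums obtained from them by inserting $x(t)$, $c(t)$ and $I$ into the $m_k$ and $\phi_{p,q}$) are assumed to make sense, and may be rearranged, differentiated term by term, and inserted in the multilinear operations; this is automatic for instance if only finitely many $m_k$ and $\phi_{p,q}$ are nonzero. *)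

theory Defs
  imports "HOL-Computational_Algebra.Computational_Algebra" "HOL-Library.Countable"
begin

section \<open>Infinite sums\<close>

text \<open>
  No topology is given on \<open>A\<close> or on the ground field, so the meaning of an infinite sum is a
  parameter: \<open>hs f N s\<close> reads ``the family \<open>f\<close>, indexed by \<open>N\<close>, has the sum \<open>s\<close>''.  The locale
  states the rules of calculation.  Finite support (see \<open>finite_support_summation\<close> below) is one
  model, unconditional convergence in a complete Hausdorff topological vector space is another.
  The two regrouping rules together contain every rearrangement: \<open>\<pi>\<close> may be a bijection, an
  inclusion (\<open>M\<close> larger than \<open>N\<close>, empty fibres) or a genuine partition into blocks.
\<close>

locale summation = vector_space sc
  for sc :: "'k::field_char_0 \<Rightarrow> 'v::ab_group_add \<Rightarrow> 'v" +
  fixes hs :: "(nat \<Rightarrow> 'v) \<Rightarrow> nat set \<Rightarrow> 'v \<Rightarrow> bool"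
  assumes hs_unique: "hs f N s \<Longrightarrow> hs f N s' \<Longrightarrow> s = s'"
    and hs_finite: "finite N \<Longrightarrow> hs f N (sum f N)"
    and hs_add: "hs f N s \<Longrightarrow> hs g N s' \<Longrightarrow> hs (\<lambda>i. f i + g i) N (s + s')"
    and hs_scale: "hs f N s \<Longrightarrow> hs (\<lambda>i. sc r (f i)) N (sc r s)"
    and hs_block: "hs f N s \<Longrightarrow> \<exists>u. hs f {i \<in> N. \<pi> i = (j::nat)} u"
    and hs_regroup: "hs f N s \<Longrightarrow> \<pi> ` N \<subseteq> M \<Longrightarrow>
      (\<And>j. j \<in> M \<Longrightarrow> hs f {i \<in> N. \<pi> i = (j::nat)} (u j)) \<Longrightarrow> hs u M s"

definition csums :: "((nat \<Rightarrow> 'v) \<Rightarrow> nat set \<Rightarrow> 'v \<Rightarrow> bool) \<Rightarrow> ('i::countable \<Rightarrow> 'v) \<Rightarrow> 'i set \<Rightarrow> 'v \<Rightarrow> bool"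
  where "csums hs f I s \<longleftrightarrow> hs (\<lambda>n. f (from_nat n)) (to_nat ` I) s"

text \<open>
  A family of polynomials in \<open>t\<close> (given by their coefficient sequences \<open>f i\<close>) can be summed if the
  family of all their coefficients, over all members and all powers of \<open>t\<close>, can be summed.
\<close>

definition tsummable :: "((nat \<Rightarrow> 'v) \<Rightarrow> nat set \<Rightarrow> 'v \<Rightarrow> bool) \<Rightarrow> ('i::countable \<Rightarrow> nat \<Rightarrow> 'v) \<Rightarrow> 'i set \<Rightarrow> bool"
  where "tsummable hs f I \<longleftrightarrow> (\<exists>s. csums hs (\<lambda>(i, n). f i n) (I \<times> UNIV) s)"

section \<open>\<open>A\<^sub>\<infinity>\<close>-algebras\<close>

text \<open>
  \<open>G d\<close> is the subspace of elements of degree \<open>d\<close>.  The operation \<open>m\<^sub>k\<close> is \<open>m\<close> on lists of length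
  \<open>k \<ge> 1\<close>; the value \<open>m []\<close> is irrelevant.  Signs depend on the degrees of the arguments, which
  are passed along as a list of integers.
\<close>

definition homogeneous :: "(int \<Rightarrow> 'a set) \<Rightarrow> 'a list \<Rightarrow> int list \<Rightarrow> bool"
  where "homogeneous G xs ds \<longleftrightarrow> list_all2 (\<lambda>x d. x \<in> G d) xs ds"

definition sdeg :: "int list \<Rightarrow> int"
  where "sdeg ds = (\<Sum>d\<leftarrow>ds. d - 1)"

definition multilinear :: "('k::field \<Rightarrow> 'a::ab_group_add \<Rightarrow> 'a) \<Rightarrow> ('k \<Rightarrow> 'v::ab_group_add \<Rightarrow> 'v) \<Rightarrow> ('a list \<Rightarrow> 'v) \<Rightarrow> bool"
  where "multilinear sc sc' f \<longleftrightarrow> (\<forall>us vs. Vector_Spaces.linear sc sc' (\<lambda>x. f (us @ x # vs)))"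

definition ainf_term :: "('k::field \<Rightarrow> 'a \<Rightarrow> 'a) \<Rightarrow> ('a list \<Rightarrow> 'a) \<Rightarrow> int list \<Rightarrow> 'a list \<Rightarrow> nat \<Rightarrow> nat \<Rightarrow> 'a"
  where "ainf_term sc m ds xs i j =
    sc ((-1) powi sdeg (take i ds)) (m (take i xs @ m (take j (drop i xs)) # drop (i + j) xs))"

definition cocycles :: "('a list \<Rightarrow> 'a::zero) \<Rightarrow> 'a set"
  where "cocycles m = {a. m [a] = 0}"

definition coboundaries :: "('a list \<Rightarrow> 'a) \<Rightarrow> 'a set"
  where "coboundaries m = range (\<lambda>a. m [a])"

locale a_infinity_algebra = vector_space sc
  for sc :: "'k::field_char_0 \<Rightarrow> 'a::ab_group_add \<Rightarrow> 'a" +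
  fixes G :: "int \<Rightarrow> 'a set" and m :: "'a list \<Rightarrow> 'a"
  assumes graded_subspace: "subspace (G d)"
    and graded_direct_sum:
      "\<exists>!f. (\<forall>d. f d \<in> G d) \<and> finite {d. f d \<noteq> 0} \<and> a = (\<Sum>d | f d \<noteq> 0. f d)"
    and m_multilinear: "multilinear sc sc m"
    and m_degree: "homogeneous G xs ds \<Longrightarrow> xs \<noteq> [] \<Longrightarrow> m xs \<in> G (sdeg ds + 2)"
    and a_infinity_relation: "homogeneous G xs ds \<Longrightarrow>
      (\<Sum>(i, j) \<in> {(i, j). 1 \<le> j \<and> i + j \<le> length xs}. ainf_term sc m ds xs i j) = 0"
    and finite_dim_cohomology: "\<exists>B. finite B \<and> B \<subseteq> cocycles m \<and> cocycles m \<subseteq> span (B \<union> coboundaries m)"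

locale unital_a_infinity_algebra = a_infinity_algebra sc G m
  for sc :: "'k::field_char_0 \<Rightarrow> 'a::ab_group_add \<Rightarrow> 'a" and G :: "int \<Rightarrow> 'a set" and m +
  fixes e :: 'a
  assumes unit_degree: "e \<in> G 0"
    and unit_left: "m [e, x] = x"
    and unit_right: "x \<in> G d \<Longrightarrow> sc ((-1) powi d) (m [x, e]) = x"
    and unit_other: "e \<in> set xs \<Longrightarrow> length xs \<noteq> 2 \<Longrightarrow> m xs = 0"

section \<open>Strong homotopy inner products\<close>

text \<open>
  \<open>\<phi> a v b w\<close> is \<open>\<phi>\<^sub>p\<^sub>,\<^sub>q(a\<^sub>1,\<dots>,a\<^sub>p,v,b\<^sub>1,\<dots>,b\<^sub>q)(w)\<close> with \<open>v\<close> the bimodule entry, \<open>p = length a\<close> and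
  \<open>q = length b\<close>.  In \<open>bimod_term1\<close> the operation \<open>m\<^sub>j\<close> is applied to the \<open>j\<close> entries of
  \<open>(a\<^sub>1,\<dots>,a\<^sub>p,v,b\<^sub>1,\<dots>,b\<^sub>q)\<close> that follow the first \<open>i\<close> ones; the three cases are: string left of \<open>v\<close>,
  string containing \<open>v\<close>, string right of \<open>v\<close>.
\<close>

definition bimod_term1 :: "('a list \<Rightarrow> 'a) \<Rightarrow> ('a list \<Rightarrow> 'a \<Rightarrow> 'a list \<Rightarrow> 'a \<Rightarrow> 'k::field) \<Rightarrow>
    int list \<Rightarrow> int \<Rightarrow> int list \<Rightarrow> 'a list \<Rightarrow> 'a \<Rightarrow> 'a list \<Rightarrow> 'a \<Rightarrow> nat \<Rightarrow> nat \<Rightarrow> 'k"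
  where "bimod_term1 m \<phi> da dv db a v b w i j = (let p = length a in
    (-1) powi sdeg (take i (da @ dv # db)) *
    (if i + j \<le> p then
       \<phi> (take i a @ m (take j (drop i a)) # drop (i + j) a) v b w
     else if i \<le> p then
       \<phi> (take i a) (m (drop i a @ v # take (i + j - p - 1) b)) (drop (i + j - p - 1) b) w
     else
       \<phi> a v (take (i - p - 1) b @ m (take j (drop (i - p - 1) b)) # drop (i - p - 1 + j) b) w))"

definition bimod_term2 :: "('a list \<Rightarrow> 'a) \<Rightarrow> ('a list \<Rightarrow> 'a \<Rightarrow> 'a list \<Rightarrow> 'a \<Rightarrow> 'k::field) \<Rightarrow>
    int list \<Rightarrow> int \<Rightarrow> int list \<Rightarrow> int \<Rightarrow> 'a list \<Rightarrow> 'a \<Rightarrow> 'a list \<Rightarrow> 'a \<Rightarrow> nat \<Rightarrow> nat \<Rightarrow> 'k"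
  where "bimod_term2 m \<phi> da dv db dw a v b w i j =
    (-1) powi (sdeg (take i da) * (sdeg (drop i da) + (dv - 1) + sdeg db + (dw - 1))
               + sdeg (drop i da) + (dv - 1) + sdeg (take j db)) *
    \<phi> (drop i a) v (take j b) (m (drop j b @ w # take i a))"

text \<open>
  \<open>bracket \<phi> ds xs r s\<close> is \<open>[r,s]\<close> for the family \<open>xs\<close> with degrees \<open>ds\<close>; positions count from 0.
  The entries before and after the underlined one are those of the rotation
  \<open>(x\<^sub>s\<^sub>+\<^sub>1,\<dots>,x\<^sub>n,x\<^sub>1,\<dots>,x\<^sub>s)\<close>.
\<close>

definition bracket :: "('a list \<Rightarrow> 'a \<Rightarrow> 'a list \<Rightarrow> 'a \<Rightarrow> 'k::field) \<Rightarrow> int list \<Rightarrow> 'a list \<Rightarrow> nat \<Rightarrow> nat \<Rightarrow> 'k"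
  where "bracket \<phi> ds xs r s =
    (-1) powi (sdeg (take (Suc s) ds) * sdeg (drop (Suc s) ds)) *
    (if s < r then
       \<phi> (take (r - Suc s) (drop (Suc s) xs)) (xs ! r) (drop (Suc r) xs @ take s xs) (xs ! s)
     else
       \<phi> (drop (Suc s) xs @ take r xs) (xs ! r) (drop (Suc r) (take s xs)) (xs ! s))"

locale a_infinity_bimodule_map_to_dual = a_infinity_algebra sc G m
  for sc :: "'k::field_char_0 \<Rightarrow> 'a::ab_group_add \<Rightarrow> 'a" and G :: "int \<Rightarrow> 'a set" and m +
  fixes \<phi> :: "'a list \<Rightarrow> 'a \<Rightarrow> 'a list \<Rightarrow> 'a \<Rightarrow> 'k"
  assumes linear_left: "multilinear sc (*) (\<lambda>a. \<phi> a v b w)"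
    and linear_bimodule_entry: "Vector_Spaces.linear sc (*) (\<lambda>v. \<phi> a v b w)"
    and linear_right: "multilinear sc (*) (\<lambda>b. \<phi> a v b w)"
    and linear_dual_entry: "Vector_Spaces.linear sc (*) (\<phi> a v b)"
    and bimodule_relation:
      "homogeneous G a da \<Longrightarrow> v \<in> G dv \<Longrightarrow> homogeneous G b db \<Longrightarrow> w \<in> G dw \<Longrightarrow>
        (\<Sum>(i, j) \<in> {(i, j). 1 \<le> j \<and> i + j \<le> length a + length b + 1}.
            bimod_term1 m \<phi> da dv db a v b w i j)
        + (\<Sum>(i, j) \<in> {..length a} \<times> {..length b}. bimod_term2 m \<phi> da dv db dw a v b w i j) = 0"

locale strong_homotopy_inner_product = a_infinity_bimodule_map_to_dual sc G m \<phi>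
  for sc :: "'k::field_char_0 \<Rightarrow> 'a::ab_group_add \<Rightarrow> 'a" and G :: "int \<Rightarrow> 'a set" and m \<phi> +
  assumes skew_symmetry:
      "homogeneous G a da \<Longrightarrow> v \<in> G dv \<Longrightarrow> homogeneous G b db \<Longrightarrow> w \<in> G dw \<Longrightarrow>
        \<phi> a v b w = - ((-1) powi ((sdeg da + (dv - 1)) * (sdeg db + (dw - 1)))) * \<phi> b w a v"
    and closedness:
      "homogeneous G xs ds \<Longrightarrow> i < j \<Longrightarrow> j < k \<Longrightarrow> k < length xs \<Longrightarrow>
        bracket \<phi> ds xs i j + bracket \<phi> ds xs j k + bracket \<phi> ds xs k i = 0"
    and homological_nondegeneracy:
      "y \<in> cocycles m \<Longrightarrow> y \<notin> coboundaries m \<Longrightarrow> \<exists>z \<in> cocycles m. \<phi> [] y [] z \<noteq> 0"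

definition unital_bimodule_map :: "('k \<Rightarrow> 'a \<Rightarrow> 'a) \<Rightarrow> 'a \<Rightarrow> ('a list \<Rightarrow> 'a \<Rightarrow> 'a list \<Rightarrow> 'a \<Rightarrow> 'k::field) \<Rightarrow> bool"
  where "unital_bimodule_map sc e \<phi> \<longleftrightarrow>
    (\<forall>a v b w. (\<exists>r. sc r e \<in> set a \<union> set b) \<longrightarrow> \<phi> a v b w = 0)"

section \<open>Maurer--Cartan elements and gauge equivalence\<close>

definition maurer_cartan :: "(int \<Rightarrow> 'a set) \<Rightarrow> ('a list \<Rightarrow> 'a::zero) \<Rightarrow>
    ((nat \<Rightarrow> 'a) \<Rightarrow> nat set \<Rightarrow> 'a \<Rightarrow> bool) \<Rightarrow> 'a set"
  where "maurer_cartan G m hsA = {b \<in> G 1. csums hsA (\<lambda>k::nat. m (replicate k b)) {1..} 0}"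

text \<open>
  \<open>A[t]\<close> is the library type of polynomials with coefficients in the abelian group \<open>A\<close>.
  \<open>poly_ext f\<close> is the extension of a multilinear map \<open>f\<close> to polynomials in \<open>t\<close>, and
  \<open>poly_ext f ps n\<close> is the coefficient of \<open>t\<^sup>n\<close> in its value at \<open>ps\<close>.
\<close>

definition poly_ext :: "('a::zero list \<Rightarrow> 'v::comm_monoid_add) \<Rightarrow> 'a poly list \<Rightarrow> nat \<Rightarrow> 'v"
  where "poly_ext f ps n =
    (\<Sum>ns | length ns = length ps \<and> sum_list ns = n. f (map2 coeff ps ns))"

definition poly_in :: "'a::zero set \<Rightarrow> 'a poly \<Rightarrow> bool"
  where "poly_in V x \<longleftrightarrow> (\<forall>n. coeff x n \<in> V)"

definition peval :: "('k::field \<Rightarrow> 'a::comm_monoid_add \<Rightarrow> 'a) \<Rightarrow> 'a poly \<Rightarrow> 'k \<Rightarrow> 'a"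
  where "peval sc x t = (\<Sum>n\<le>degree x. sc (t ^ n) (coeff x n))"

text \<open>
  The equation \<open>x'(t) = \<Sum> m(x(t),\<dots>,x(t),c(t),x(t),\<dots>,x(t))\<close>, one coefficient of \<open>t\<close> at a time;
  \<open>r\<close> and \<open>s\<close> count the entries before and after \<open>c(t)\<close>.
\<close>

definition gauge_path :: "('k::field \<Rightarrow> 'a::ab_group_add \<Rightarrow> 'a) \<Rightarrow> (int \<Rightarrow> 'a set) \<Rightarrow> ('a list \<Rightarrow> 'a) \<Rightarrow>
    ((nat \<Rightarrow> 'a) \<Rightarrow> nat set \<Rightarrow> 'a \<Rightarrow> bool) \<Rightarrow> 'a poly \<Rightarrow> 'a poly \<Rightarrow> bool"
  where "gauge_path sc G m hsA x c \<longleftrightarrow> poly_in (G 1) x \<and> poly_in (G 0) c \<and>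
    (\<forall>n. csums hsA (\<lambda>(r, s). poly_ext m (replicate r x @ c # replicate s x) n) UNIV
           (sc (of_nat (Suc n)) (coeff x (Suc n))))"

definition gauge_equivalent :: "('k::field \<Rightarrow> 'a::ab_group_add \<Rightarrow> 'a) \<Rightarrow> (int \<Rightarrow> 'a set) \<Rightarrow> ('a list \<Rightarrow> 'a) \<Rightarrow>
    ((nat \<Rightarrow> 'a) \<Rightarrow> nat set \<Rightarrow> 'a \<Rightarrow> bool) \<Rightarrow> 'a \<Rightarrow> 'a \<Rightarrow> bool"
  where "gauge_equivalent sc G m hsA b b' \<longleftrightarrow>
    b \<in> maurer_cartan G m hsA \<and> b' \<in> maurer_cartan G m hsA \<and>
    (\<exists>x c. gauge_path sc G m hsA x c \<and> peval sc x 0 = b \<and> peval sc x 1 = b')"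

section \<open>The function \<open>\<Psi>\<close>\<close>

definition Psi :: "('a list \<Rightarrow> 'a \<Rightarrow> 'a list \<Rightarrow> 'a \<Rightarrow> 'k::field_char_0) \<Rightarrow> 'a \<Rightarrow>
    ((nat \<Rightarrow> 'k) \<Rightarrow> nat set \<Rightarrow> 'k \<Rightarrow> bool) \<Rightarrow> 'a \<Rightarrow> 'k"
  where "Psi \<phi> e hsK x = (THE S.
    csums hsK (\<lambda>(p, q). 1 / of_nat (p + q + 1) * \<phi> (replicate p x) x (replicate q x) e) UNIV S)"

text \<open>\<open>\<Psi>(x(t))\<close> for \<open>x(t)\<close> in \<open>A[t]\<close>: an infinite sum of polynomials in \<open>t\<close>, hence a series in \<open>t\<close>.\<close>

definition Psi_path_term :: "('a::zero list \<Rightarrow> 'a \<Rightarrow> 'a list \<Rightarrow> 'a \<Rightarrow> 'k::field_char_0) \<Rightarrow> 'a \<Rightarrow>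
    'a poly \<Rightarrow> nat \<times> nat \<Rightarrow> nat \<Rightarrow> 'k"
  where "Psi_path_term \<phi> e x = (\<lambda>(p, q) n. 1 / of_nat (p + q + 1) *
    poly_ext (\<lambda>ys. \<phi> (take p ys) (ys ! p) (drop (Suc p) ys) e)
      (replicate p x @ x # replicate q x) n)"

definition Psi_path :: "('a::zero list \<Rightarrow> 'a \<Rightarrow> 'a list \<Rightarrow> 'a \<Rightarrow> 'k::field_char_0) \<Rightarrow> 'a \<Rightarrow>
    ((nat \<Rightarrow> 'k) \<Rightarrow> nat set \<Rightarrow> 'k \<Rightarrow> bool) \<Rightarrow> 'a poly \<Rightarrow> 'k fps"
  where "Psi_path \<phi> e hsK x =
    Abs_fps (\<lambda>n. THE S. csums hsK (\<lambda>pq. Psi_path_term \<phi> e x pq n) UNIV S)"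

section \<open>The convention on infinite sums\<close>

text \<open>Infinite sums in \<open>A\<close> and in the field, which may be inserted in the multilinear operations.\<close>

locale summation_in_operations = A: summation sc hsA + K: summation "(*)" hsK
  for sc :: "'k::field_char_0 \<Rightarrow> 'a::ab_group_add \<Rightarrow> 'a"
    and hsA :: "(nat \<Rightarrow> 'a) \<Rightarrow> nat set \<Rightarrow> 'a \<Rightarrow> bool"
    and hsK :: "(nat \<Rightarrow> 'k) \<Rightarrow> nat set \<Rightarrow> 'k \<Rightarrow> bool" +
  fixes m :: "'a list \<Rightarrow> 'a" and \<phi> :: "'a list \<Rightarrow> 'a \<Rightarrow> 'a list \<Rightarrow> 'a \<Rightarrow> 'k"
  assumes insert_m: "hsA f N s \<Longrightarrow> hsA (\<lambda>i. m (us @ f i # vs)) N (m (us @ s # vs))"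
    and insert_left: "hsA f N s \<Longrightarrow> hsK (\<lambda>i. \<phi> (us @ f i # vs) v b w) N (\<phi> (us @ s # vs) v b w)"
    and insert_bimodule_entry: "hsA f N s \<Longrightarrow> hsK (\<lambda>i. \<phi> a (f i) b w) N (\<phi> a s b w)"
    and insert_right: "hsA f N s \<Longrightarrow> hsK (\<lambda>i. \<phi> a v (us @ f i # vs) w) N (\<phi> a v (us @ s # vs) w)"
    and insert_dual_entry: "hsA f N s \<Longrightarrow> hsK (\<lambda>i. \<phi> a v b (f i)) N (\<phi> a v b s)"

text \<open>
  The sums attached to \<open>x(t)\<close> and \<open>c(t)\<close>: those of the Maurer--Cartan equation, of the gauge
  equation and of \<open>\<Psi>\<close>, and the sums obtained from them by insertion, namely over all terms of the
  \<open>A\<^sub>\<infinity>\<close>-relations with arguments \<open>x(t),\<dots>,x(t),c(t),x(t),\<dots>,x(t)\<close> and over all terms of the bimodule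
  relations with arguments \<open>x(t),\<dots>,x(t)\<close>, bimodule entry \<open>c(t)\<close>, \<open>x(t),\<dots>,x(t)\<close>, evaluated at \<open>I\<close>.
\<close>

definition sums_make_sense :: "('k::field_char_0 \<Rightarrow> 'a::ab_group_add \<Rightarrow> 'a) \<Rightarrow> ('a list \<Rightarrow> 'a) \<Rightarrow> 'a \<Rightarrow>
    ('a list \<Rightarrow> 'a \<Rightarrow> 'a list \<Rightarrow> 'a \<Rightarrow> 'k) \<Rightarrow> ((nat \<Rightarrow> 'a) \<Rightarrow> nat set \<Rightarrow> 'a \<Rightarrow> bool) \<Rightarrow>
    ((nat \<Rightarrow> 'k) \<Rightarrow> nat set \<Rightarrow> 'k \<Rightarrow> bool) \<Rightarrow> 'a poly \<Rightarrow> 'a poly \<Rightarrow> bool"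
  where "sums_make_sense sc m e \<phi> hsA hsK x c \<longleftrightarrow>
    tsummable hsA (\<lambda>k::nat. poly_ext m (replicate k x)) {1..} \<and>
    tsummable hsA (\<lambda>(r, s). poly_ext m (replicate r x @ c # replicate s x)) UNIV \<and>
    tsummable hsK (Psi_path_term \<phi> e x) UNIV \<and>
    tsummable hsA
      (\<lambda>(r, s, i, j). poly_ext
        (\<lambda>ys. ainf_term sc m (replicate r 1 @ 0 # replicate s 1) ys i j)
        (replicate r x @ c # replicate s x))
      {(r, s, i, j). 1 \<le> j \<and> i + j \<le> r + s + 1} \<and>
    tsummable hsK
      (\<lambda>(p, q, i, j). poly_ext
        (\<lambda>ys. bimod_term1 m \<phi> (replicate p 1) 0 (replicate q 1)
                (take p ys) (ys ! p) (drop (Suc p) ys) e i j)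
        (replicate p x @ c # replicate q x))
      {(p, q, i, j). 1 \<le> j \<and> i + j \<le> p + q + 1} \<and>
    tsummable hsK
      (\<lambda>(p, q, i, j). poly_ext
        (\<lambda>ys. bimod_term2 m \<phi> (replicate p 1) 0 (replicate q 1) 0
                (take p ys) (ys ! p) (drop (Suc p) ys) e i j)
        (replicate p x @ c # replicate q x))
      {(p, q, i, j). i \<le> p \<and> j \<le> q}"

section \<open>The finite case\<close>

text \<open>
  In the purely algebraic model a family has a sum if it has finite support.  It satisfies the rules
  above for every \<open>A\<^sub>\<infinity>\<close>-algebra and every bimodule map, and all sums make sense if only finitely many
  \<open>m\<^sub>k\<close> and \<open>\<phi>\<^sub>p\<^sub>,\<^sub>q\<close> are nonzero.
\<close>

definition finsupp_sums :: "(nat \<Rightarrow> 'v::comm_monoid_add) \<Rightarrow> nat set \<Rightarrow> 'v \<Rightarrow> bool"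
  where "finsupp_sums f N s \<longleftrightarrow> finite {i \<in> N. f i \<noteq> 0} \<and> s = sum f {i \<in> N. f i \<noteq> 0}"


lemma finsupp_sums_iff_superset:
  assumes "finite S" "S \<subseteq> N" "\<And>i. i \<in> N - S \<Longrightarrow> f i = 0"
  shows "finsupp_sums f N s \<longleftrightarrow> s = sum f S"
proof -
  have sub: "{i \<in> N. f i \<noteq> 0} \<subseteq> S" using assms by auto
  then have "finite {i \<in> N. f i \<noteq> 0}" using assms(1) finite_subset by blast
  moreover have "sum f {i \<in> N. f i \<noteq> 0} = sum f S"
    by (rule sum.mono_neutral_left) (use sub assms in auto)
  ultimately show ?thesis by (auto simp: finsupp_sums_def)
qed

lemma finsupp_sumsE:
  assumes "finsupp_sums f N s"
  obtains S where "finite S" "S \<subseteq> N" "\<And>i. i \<in> N - S \<Longrightarrow> f i = 0" "s = sum f S"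
  using assms by (intro that[of "{i \<in> N. f i \<noteq> 0}"]) (auto simp: finsupp_sums_def)

lemma finsupp_sums_linear:
  assumes "Vector_Spaces.linear sc sc' h" "finsupp_sums f N s"
  shows "finsupp_sums (\<lambda>i. h (f i)) N (h s)"
proof -
  interpret h: Vector_Spaces.linear sc sc' h by fact
  obtain S where S: "finite S" "S \<subseteq> N" "\<And>i. i \<in> N - S \<Longrightarrow> f i = 0" "s = sum f S"
    using assms(2) by (rule finsupp_sumsE) blast
  show ?thesis
    using S by (subst finsupp_sums_iff_superset[of S]) (auto simp: h.zero h.sum)
qed

lemma finite_support_summation:
  fixes sc :: "'k::field_char_0 \<Rightarrow> 'v::ab_group_add \<Rightarrow> 'v"
  assumes "vector_space sc"
  shows "summation sc finsupp_sums"
proof -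
  interpret vector_space sc by fact
  show ?thesis
  proof unfold_locales
    fix f :: "nat \<Rightarrow> 'v" and N s s'
    assume "finsupp_sums f N s" "finsupp_sums f N s'"
    then show "s = s'" by (simp add: finsupp_sums_def)
  next
    fix f :: "nat \<Rightarrow> 'v" and N :: "nat set"
    assume "finite N"
    then show "finsupp_sums f N (sum f N)" by (subst finsupp_sums_iff_superset[of N]) auto
  next
    fix f g :: "nat \<Rightarrow> 'v" and N s s'
    assume "finsupp_sums f N s" "finsupp_sums g N s'"
    then obtain S T where S: "finite S" "S \<subseteq> N" "\<And>i. i \<in> N - S \<Longrightarrow> f i = 0" "s = sum f S"
      and T: "finite T" "T \<subseteq> N" "\<And>i. i \<in> N - T \<Longrightarrow> g i = 0" "s' = sum g T"
      by (auto elim!: finsupp_sumsE)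
    have "sum f S = sum f (S \<union> T)" "sum g T = sum g (S \<union> T)"
      by (rule sum.mono_neutral_left; use S T in auto)+
    then show "finsupp_sums (\<lambda>i. f i + g i) N (s + s')"
      using S T by (subst finsupp_sums_iff_superset[of "S \<union> T"]) (auto simp: sum.distrib)
  next
    fix f :: "nat \<Rightarrow> 'v" and N s r
    assume "finsupp_sums f N s"
    then show "finsupp_sums (\<lambda>i. sc r (f i)) N (sc r s)"
      using finsupp_sums_linear[of sc sc "sc r"] linear_scale_self by blast
  next
    fix f :: "nat \<Rightarrow> 'v" and N s and \<pi> :: "nat \<Rightarrow> nat" and j
    assume "finsupp_sums f N s"
    then show "\<exists>u. finsupp_sums f {i \<in> N. \<pi> i = j} u"
      by (auto simp: finsupp_sums_def elim: finite_subset[rotated])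
  next
    fix f u :: "nat \<Rightarrow> 'v" and N M s and \<pi> :: "nat \<Rightarrow> nat"
    assume f: "finsupp_sums f N s" and M: "\<pi> ` N \<subseteq> M"
      and u: "\<And>j. j \<in> M \<Longrightarrow> finsupp_sums f {i \<in> N. \<pi> i = j} (u j)"
    obtain S where S: "finite S" "S \<subseteq> N" "\<And>i. i \<in> N - S \<Longrightarrow> f i = 0" "s = sum f S"
      using f by (rule finsupp_sumsE) blast
    have u': "u j = sum f {i \<in> S. \<pi> i = j}" if "j \<in> M" for j
      using u[OF that] S by (subst (asm) finsupp_sums_iff_superset[of "{i \<in> S. \<pi> i = j}"]) auto
    have "sum u (\<pi> ` S) = (\<Sum>j\<in>\<pi> ` S. sum f {i \<in> S. \<pi> i = j})"
      using S M by (intro sum.cong) (auto intro!: u')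
    also have "\<dots> = sum f S" using S(1) by (rule sum.image_gen[symmetric])
    finally have "sum u (\<pi> ` S) = sum f S" .
    moreover have "u j = 0" if "j \<in> M - \<pi> ` S" for j
    proof -
      have "{i \<in> S. \<pi> i = j} = {}" using that by auto
      then show ?thesis using u'[of j] that by (metis DiffD1 sum.empty)
    qed
    moreover have "\<pi> ` S \<subseteq> M" using S(2) M by blast
    ultimately show "finsupp_sums u M s"
      using S(1,4) by (subst finsupp_sums_iff_superset[of "\<pi> ` S"]) auto
  qed
qed

lemma finite_support_summation_in_operations:
  fixes sc :: "'k::field_char_0 \<Rightarrow> 'a::ab_group_add \<Rightarrow> 'a"
  assumes "a_infinity_bimodule_map_to_dual sc G m \<phi>"
  shows "summation_in_operations sc finsupp_sums finsupp_sums m \<phi>"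
proof -
  interpret a_infinity_bimodule_map_to_dual sc G m \<phi> by fact
  have "vector_space ((*) :: 'k \<Rightarrow> 'k \<Rightarrow> 'k)" by unfold_locales (auto simp: algebra_simps)
  then interpret A: summation sc finsupp_sums + K: summation "(*) :: 'k \<Rightarrow> 'k \<Rightarrow> 'k" finsupp_sums
    by (auto intro!: finite_support_summation vector_space_axioms)
  note lin = finsupp_sums_linear[where sc = sc]
  show ?thesis
  proof unfold_locales
    fix f :: "nat \<Rightarrow> 'a" and N s us vs a v b w
    assume f: "finsupp_sums f N s"
    show "finsupp_sums (\<lambda>i. m (us @ f i # vs)) N (m (us @ s # vs))"
      by (rule lin[OF _ f]) (use m_multilinear in \<open>auto simp: multilinear_def\<close>)
    show "finsupp_sums (\<lambda>i. \<phi> (us @ f i # vs) v b w) N (\<phi> (us @ s # vs) v b w)"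
      by (rule lin[OF _ f, where h = "\<lambda>x. \<phi> (us @ x # vs) v b w" and sc' = "(*)"])
        (use linear_left in \<open>auto simp: multilinear_def\<close>)
    show "finsupp_sums (\<lambda>i. \<phi> a (f i) b w) N (\<phi> a s b w)"
      by (rule lin[OF linear_bimodule_entry f])
    show "finsupp_sums (\<lambda>i. \<phi> a v (us @ f i # vs) w) N (\<phi> a v (us @ s # vs) w)"
      by (rule lin[OF _ f, where h = "\<lambda>x. \<phi> a v (us @ x # vs) w" and sc' = "(*)"])
        (use linear_right in \<open>auto simp: multilinear_def\<close>)
    show "finsupp_sums (\<lambda>i. \<phi> a v b (f i)) N (\<phi> a v b s)"
      by (rule lin[OF linear_dual_entry f])
  qed
qed

lemma linear_map_zero:
  assumes "Vector_Spaces.linear sc sc' h"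
  shows "h 0 = 0"
proof -
  interpret Vector_Spaces.linear sc sc' h by fact
  show ?thesis by (rule zero)
qed

lemma multilinear_zero:
  assumes "multilinear sc sc' f" "0 \<in> set xs"
  shows "f xs = 0"
proof -
  obtain us vs where xs: "xs = us @ 0 # vs" using assms(2) by (meson split_list)
  interpret Vector_Spaces.linear sc sc' "\<lambda>x. f (us @ x # vs)"
    using assms(1) by (simp add: multilinear_def)
  show ?thesis using zero xs by simp
qed

lemma poly_ext_finite:
  assumes "\<And>ys. length ys = length ps \<Longrightarrow> 0 \<in> set ys \<Longrightarrow> f ys = 0"
  shows "finite {n. poly_ext f ps n \<noteq> 0}"
proof (rule finite_subset)
  show "{n. poly_ext f ps n \<noteq> 0} \<subseteq> {..(\<Sum>p\<leftarrow>ps. degree p)}"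
  proof
    fix n assume "n \<in> {n. poly_ext f ps n \<noteq> 0}"
    then obtain ns where ns: "length ns = length ps" "sum_list ns = n" "f (map2 coeff ps ns) \<noteq> 0"
      unfolding poly_ext_def by (auto elim!: sum.not_neutral_contains_not_neutral)
    have "length (map2 coeff ps ns) = length ps" using ns(1) by simp
    then have "0 \<notin> set (map2 coeff ps ns)" using assms ns(3) by blast
    with ns(1) have "sum_list ns \<le> (\<Sum>p\<leftarrow>ps. degree p)"
    proof (induction ns ps rule: list_induct2)
      case (Cons k ns p ps)
      then have "k \<le> degree p" using le_degree[of p k] by auto
      then show ?case using Cons by auto
    qed simp
    then show "n \<in> {..(\<Sum>p\<leftarrow>ps. degree p)}" using ns by simp
  qed
qed simp

lemma poly_ext_0:
  assumes "\<And>ys. length ys = length ps \<Longrightarrow> f ys = 0"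
  shows "poly_ext f ps n = 0"
  unfolding poly_ext_def by (rule sum.neutral) (use assms in auto)

lemma tsummable_finsupp:
  assumes "finite F" "\<And>i n. i \<in> I - F \<Longrightarrow> f i n = 0" "\<And>i. i \<in> I \<Longrightarrow> finite {n. f i n \<noteq> 0}"
  shows "tsummable finsupp_sums f I"
proof -
  have "{i \<in> to_nat ` (I \<times> (UNIV :: nat set)). (\<lambda>(i, n). f i n) (from_nat i) \<noteq> 0}
      \<subseteq> to_nat ` (SIGMA i : F \<inter> I. {n. f i n \<noteq> 0})"
  proof
    fix l assume "l \<in> {i \<in> to_nat ` (I \<times> (UNIV :: nat set)). (\<lambda>(i, n). f i n) (from_nat i) \<noteq> 0}"
    then obtain i n where "l = to_nat (i, n)" "i \<in> I" "f i n \<noteq> 0" by auto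
    then show "l \<in> to_nat ` (SIGMA i : F \<inter> I. {n. f i n \<noteq> 0})" using assms(2)[of i n] by auto
  qed
  moreover have "finite (SIGMA i : F \<inter> I. {n. f i n \<noteq> 0})" using assms by blast
  ultimately show ?thesis unfolding tsummable_def csums_def finsupp_sums_def
    by (meson finite_imageI finite_subset)
qed

lemma zero_in_takes: "0 \<in> set ys \<Longrightarrow> 0 \<notin> set (take i ys) \<Longrightarrow> 0 \<in> set (drop i ys)"
  by (metis Un_iff append_take_drop_id set_append)

lemma sums_make_sense_finite:
  fixes sc :: "'k::field_char_0 \<Rightarrow> 'a::ab_group_add \<Rightarrow> 'a"
  assumes "a_infinity_bimodule_map_to_dual sc G m \<phi>"
    and m: "\<And>xs. length xs > B \<Longrightarrow> m xs = 0"
    and \<phi>: "\<And>a v b w. length a + length b > B \<Longrightarrow> \<phi> a v b w = 0"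
  shows "sums_make_sense sc m e \<phi> finsupp_sums finsupp_sums x c"
proof -
  interpret a_infinity_bimodule_map_to_dual sc G m \<phi> by fact
  have mz: "m xs = 0" if "0 \<in> set xs" for xs using multilinear_zero m_multilinear that by blast
  have az: "\<phi> a v b w = 0" if "0 \<in> set a" for a v b w
    using multilinear_zero[OF linear_left] that by blast
  have bz: "\<phi> a v b w = 0" if "0 \<in> set b" for a v b w
    using multilinear_zero[OF linear_right] that by blast
  have vz: "\<phi> a 0 b w = 0" for a b w
    using linear_bimodule_entry[of a b w] by (rule linear_map_zero)
  have wz: "\<phi> a v b 0 = 0" for a b v
    using linear_dual_entry[of a v b] by (rule linear_map_zero)
  have vz': "\<phi> a v b w = 0" if "v = 0" for a b v w using vz that by simp
  have wz': "\<phi> a v b w = 0" if "w = 0" for a b v w using wz that by simp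
  have split3: "0 \<in> set (take p ys) \<or> ys ! p = 0 \<or> 0 \<in> set (drop (Suc p) ys)"
    if "0 \<in> set ys" "p < length ys" for ys :: "'a list" and p
    using that id_take_nth_drop[of p ys] by (metis Un_iff set_ConsD set_append)
  have A0: "ainf_term sc m ds ys i j = 0" if "0 \<in> set ys" for ds ys i j
  proof -
    have "0 \<in> set (take i ys) \<or> 0 \<in> set (take j (drop i ys)) \<or> 0 \<in> set (drop (i + j) ys)"
      using that zero_in_takes[of ys i] zero_in_takes[of "drop i ys" j] by (auto simp: add.commute)
    then have "0 \<in> set (take i ys @ m (take j (drop i ys)) # drop (i + j) ys)"
      using mz by force
    then show ?thesis by (simp add: ainf_term_def mz)
  qed
  have B1: "bimod_term1 m \<phi> da dv db a v b w i j = 0"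
    if z: "0 \<in> set a \<or> v = 0 \<or> 0 \<in> set b" for da dv db a v b w i j
  proof -
    have "0 \<in> set (take i u @ m (take j (drop i u)) # drop (i + j) u)"
      if "0 \<in> set u" for u :: "'a list" and i
    proof -
      have "0 \<in> set (take i u) \<or> 0 \<in> set (take j (drop i u)) \<or> 0 \<in> set (drop (i + j) u)"
        using that zero_in_takes[of u i] zero_in_takes[of "drop i u" j] by (auto simp: add.commute)
      then show ?thesis using mz by force
    qed
    note ins = this
    have "\<phi> (take i a) (m (drop i a @ v # take k b)) (drop k b) w = 0" for k
      using z zero_in_takes[of a i] zero_in_takes[of b k]
      by (smt (verit, ccfv_threshold) Un_iff az bz list.set_intros(1) list.set_intros(2) mz set_append vz)
    then show ?thesis
      unfolding bimod_term1_def Let_def using z ins[of a i] ins[of b "i - length a - 1"] az bz vz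
      by auto
  qed
  have B2: "bimod_term2 m \<phi> da dv db dw a v b w i j = 0"
    if z: "0 \<in> set a \<or> v = 0 \<or> 0 \<in> set b" for da dv db dw a v b w i j
  proof -
    have "\<phi> (drop i a) v (take j b) (m (drop j b @ w # take i a)) = 0"
      using z zero_in_takes[of a i] zero_in_takes[of b j]
      by (smt (verit, ccfv_threshold) Un_iff az bz list.set_intros(2) mz set_append vz wz)
    then show ?thesis by (simp add: bimod_term2_def)
  qed
  let ?N = "{..2 * B + 1}"
  note fin = finite_cartesian_product[OF finite_atMost]
  show ?thesis
    unfolding sums_make_sense_def
  proof (intro conjI)
    show "tsummable finsupp_sums (\<lambda>k::nat. poly_ext m (replicate k x)) {1..}"
    proof (rule tsummable_finsupp[of ?N], goal_cases)
      case (2 k n)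
      then show ?case by (auto intro!: poly_ext_0 m)
    next
      case (3 k)
      then show ?case by (auto intro!: poly_ext_finite mz)
    qed simp
    show "tsummable finsupp_sums (\<lambda>(r, s). poly_ext m (replicate r x @ c # replicate s x)) UNIV"
    proof (rule tsummable_finsupp[of "?N \<times> ?N"], goal_cases)
      case (2 t n)
      then show ?case by (cases t) (auto intro!: poly_ext_0 m)
    next
      case (3 t)
      then show ?case by (cases t) (auto intro!: poly_ext_finite mz)
    qed simp
    show "tsummable finsupp_sums (Psi_path_term \<phi> e x) UNIV"
    proof (rule tsummable_finsupp[of "?N \<times> ?N"])
      fix i n assume "i \<in> UNIV - ?N \<times> ?N"
      then show "Psi_path_term \<phi> e x i n = 0"
        by (auto simp: Psi_path_term_def split: prod.splits intro!: poly_ext_0 \<phi>)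
    next
      fix i :: "nat \<times> nat"
      obtain p q where i: "i = (p, q)" by fastforce
      have "finite {n. poly_ext (\<lambda>ys. \<phi> (take p ys) (ys ! p) (drop (Suc p) ys) e)
              (replicate p x @ x # replicate q x) n \<noteq> 0}"
      proof (rule poly_ext_finite)
        fix ys :: "'a list"
        assume "length ys = length (replicate p x @ x # replicate q x)" "0 \<in> set ys"
        then have "0 \<in> set (take p ys) \<or> ys ! p = 0 \<or> 0 \<in> set (drop (Suc p) ys)"
          by (intro split3) auto
        then show "\<phi> (take p ys) (ys ! p) (drop (Suc p) ys) e = 0"
          by (elim disjE) (simp_all add: az bz vz)
      qed
      then show "finite {n. Psi_path_term \<phi> e x i n \<noteq> 0}"
        by (rule rev_finite_subset) (auto simp: Psi_path_term_def i)
    qed simp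
    show "tsummable finsupp_sums
      (\<lambda>(r, s, i, j). poly_ext
        (\<lambda>ys. ainf_term sc m (replicate r 1 @ 0 # replicate s 1) ys i j)
        (replicate r x @ c # replicate s x))
      {(r, s, i, j). 1 \<le> j \<and> i + j \<le> r + s + 1}"
    proof (rule tsummable_finsupp[of "?N \<times> ?N \<times> ?N \<times> ?N"], goal_cases)
      case (2 t n)
      have "ainf_term sc m ds ys i j = 0"
        if "i + j \<le> r + s + 1" "length ys = r + s + 1" "(r, s, i, j) \<notin> ?N \<times> ?N \<times> ?N \<times> ?N"
        for ds ys i j r s
      proof (cases "j > B")
        case True
        then have "m (take j (drop i ys)) = 0" using that by (intro m) auto
        then show ?thesis by (simp add: ainf_term_def mz)
      next
        case False
        then have "m (take i ys @ m (take j (drop i ys)) # drop (i + j) ys) = 0"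
          using that by (intro m) auto
        then show ?thesis by (simp add: ainf_term_def)
      qed
      note vanish = this
      obtain r s i j where t: "t = (r, s, i, j)" by (cases t)
      show ?case unfolding t prod.case
        by (rule poly_ext_0, rule vanish[where i = i and j = j and r = r and s = s]) (use 2 in \<open>auto simp: t\<close>)
    next
      case (3 t)
      then show ?case by (cases t) (simp, rule poly_ext_finite, erule A0)
    qed simp
    show "tsummable finsupp_sums
      (\<lambda>(p, q, i, j). poly_ext
        (\<lambda>ys. bimod_term1 m \<phi> (replicate p 1) 0 (replicate q 1)
                (take p ys) (ys ! p) (drop (Suc p) ys) e i j)
        (replicate p x @ c # replicate q x))
      {(p, q, i, j). 1 \<le> j \<and> i + j \<le> p + q + 1}"
    proof (rule tsummable_finsupp[of "?N \<times> ?N \<times> ?N \<times> ?N"], goal_cases)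
      case (2 t n)
      have "bimod_term1 m \<phi> da dv db a v b w i j = 0"
        if "1 \<le> j" "i + j \<le> p + q + 1" "length a = p" "length b = q"
          "(p, q, i, j) \<notin> ?N \<times> ?N \<times> ?N \<times> ?N"
        for da dv db a v b w i j p q
      proof (cases "j > B")
        case True
        then have "m xs = 0" if "length xs = j" for xs using that by (intro m) auto
        then show ?thesis using that by (auto simp: bimod_term1_def Let_def az bz vz)
      next
        case False
        then show ?thesis using that
          by (auto simp: bimod_term1_def Let_def intro!: \<phi>)
      qed
      note vanish = this
      obtain p q i j where t: "t = (p, q, i, j)" by (cases t)
      show ?case unfolding t prod.case
        by (rule poly_ext_0, rule vanish[where i = i and j = j and p = p and q = q]) (use 2 in \<open>auto simp: t\<close>)
    next
      case (3 t)
      then show ?case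
        by (cases t) (simp, rule poly_ext_finite, rule B1, rule split3, assumption, simp)
    qed simp
    show "tsummable finsupp_sums
      (\<lambda>(p, q, i, j). poly_ext
        (\<lambda>ys. bimod_term2 m \<phi> (replicate p 1) 0 (replicate q 1) 0
                (take p ys) (ys ! p) (drop (Suc p) ys) e i j)
        (replicate p x @ c # replicate q x))
      {(p, q, i, j). i \<le> p \<and> j \<le> q}"
    proof (rule tsummable_finsupp[of "?N \<times> ?N \<times> ?N \<times> ?N"], goal_cases)
      case (2 t n)
      have "bimod_term2 m \<phi> da dv db dw a v b w i j = 0"
        if "i \<le> p" "j \<le> q" "length a = p" "length b = q"
          "(p, q, i, j) \<notin> ?N \<times> ?N \<times> ?N \<times> ?N"
        for da dv db dw a v b w i j p q
      proof (cases "p - i + j > B")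
        case True
        then show ?thesis using that by (auto simp: bimod_term2_def intro!: \<phi>)
      next
        case False
        then have "m (drop j b @ w # take i a) = 0" using that by (intro m) auto
        then show ?thesis by (simp add: bimod_term2_def wz)
      qed
      note vanish = this
      obtain p q i j where t: "t = (p, q, i, j)" by (cases t)
      show ?case unfolding t prod.case
        by (rule poly_ext_0, rule vanish[where i = i and j = j and p = p and q = q]) (use 2 in \<open>auto simp: t\<close>)
    next
      case (3 t)
      then show ?case
        by (cases t) (simp, rule poly_ext_finite, rule B2, rule split3, assumption, simp)
    qed simp
  qed
qed

end

theory Submission
  imports Defs
begin

text \<open>
  Closedness, skew symmetry and unitality show that \<open>\<phi>(\<dots>, v, \<dots>)(I)\<close> does not depend on which entry is the
  bimodule entry.  Hence the factor \<open>1/(p+q+1)\<close> cancels when \<open>\<Psi>(x(t))\<close> is differentiated: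
  \<open>\<Psi>' = \<Sum> \<phi>(x, \<dots>, x', \<dots>, x)(I)\<close>.  Insert the gauge equation for \<open>x'\<close> and sum the bimodule relations
  with bimodule entry \<open>c\<close>, evaluated at \<open>I\<close>: the terms with \<open>m(x, \<dots>, x)\<close> vanish by the
  Maurer--Cartan equation, and the second sum of the relations reduces to \<open>m\<^sub>2(I, x)\<close> and
  \<open>m\<^sub>2(x, I)\<close>, which cancel.  That \<open>x(t)\<close> is Maurer--Cartan, coefficient by coefficient in \<open>t\<close>, follows
  from \<open>x(0)\<close>: by the \<open>A\<^sub>\<infinity>\<close>-relations the Maurer--Cartan sum satisfies a linear differential equation.
\<close>

section \<open>Sums over countable index sets\<close>

context summation
begin

text \<open>The summation rules do not say that a sum depends only on the values on
  \<open>N\<close>; regrouping along the identity, with singleton fibres, yields it.\<close>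

lemma hs_cong:
  assumes "hs f N s" "\<And>i. i \<in> N \<Longrightarrow> f i = g i"
  shows "hs g N s"
proof (rule hs_regroup[OF assms(1), of "\<lambda>i. i"])
  fix j assume j: "j \<in> N"
  then have "{i \<in> N. i = j} = {j}" by auto
  then show "hs f {i \<in> N. i = j} (g j)" using hs_finite[of "{j}" f] assms(2)[OF j] by simp
qed simp

lemma csums_cong:
  assumes "csums hs f I s" "\<And>i. i \<in> I \<Longrightarrow> f i = g i"
  shows "csums hs g I s"
  unfolding csums_def
  by (rule hs_cong[OF assms(1)[unfolded csums_def]]) (use assms(2) in auto)

lemma csums_unique: "csums hs f I s \<Longrightarrow> csums hs f I s' \<Longrightarrow> s = s'"
  unfolding csums_def by (rule hs_unique)

lemma csums_finite:
  assumes "finite I"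
  shows "csums hs f I (sum f I)"
proof -
  have "(\<Sum>n\<in>to_nat ` I. f (from_nat n)) = sum f I"
    by (subst sum.reindex) (auto intro: inj_on_subset[OF inj_to_nat])
  then show ?thesis
    using hs_finite[of "to_nat ` I" "\<lambda>n. f (from_nat n)"] assms by (simp add: csums_def)
qed

lemma csums_add: "csums hs f I s \<Longrightarrow> csums hs g I s' \<Longrightarrow> csums hs (\<lambda>i. f i + g i) I (s + s')"
  unfolding csums_def by (rule hs_add)

lemma csums_scale: "csums hs f I s \<Longrightarrow> csums hs (\<lambda>i. sc r (f i)) I (sc r s)"
  unfolding csums_def by (rule hs_scale)

lemma to_nat_block:
  "{n \<in> to_nat ` I. to_nat (\<pi> (from_nat n)) = to_nat j} = to_nat ` {i \<in> I. \<pi> i = j}"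
  by auto

lemma csums_block:
  assumes "csums hs f I s"
  shows "\<exists>u. csums hs f {i \<in> I. \<pi> i = (j :: 'j::countable)} u"
  using hs_block[OF assms[unfolded csums_def], of "\<lambda>n. to_nat (\<pi> (from_nat n))" "to_nat j"]
  unfolding csums_def to_nat_block .

lemma csums_regroup:
  fixes \<pi> :: "'i::countable \<Rightarrow> 'j::countable"
  assumes "csums hs f I s" "\<pi> ` I \<subseteq> J"
    and "\<And>j. j \<in> J \<Longrightarrow> csums hs f {i \<in> I. \<pi> i = j} (u j)"
  shows "csums hs u J s"
  unfolding csums_def
proof (rule hs_regroup[OF assms(1)[unfolded csums_def], of "\<lambda>n. to_nat (\<pi> (from_nat n))"])
  show "(\<lambda>n. to_nat (\<pi> (from_nat n))) ` to_nat ` I \<subseteq> to_nat ` J" using assms(2) by auto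
  fix l assume "l \<in> to_nat ` J"
  then obtain j where "l = to_nat j" "j \<in> J" by auto
  with assms(3)[of j]
  show "hs (\<lambda>n. f (from_nat n)) {n \<in> to_nat ` I. to_nat (\<pi> (from_nat n)) = l} (u (from_nat l))"
    unfolding csums_def to_nat_block by (simp only: to_nat_block from_nat_to_nat)
qed

text \<open>Regrouping along the inclusion of \<open>I\<close>: an added index has the empty fibre,
  whose sum is 0.\<close>

lemma csums_superset:
  assumes "csums hs f I s" "I \<subseteq> J" "\<And>j. j \<in> J - I \<Longrightarrow> f j = 0"
  shows "csums hs f J s"
proof (rule csums_regroup[OF assms(1), of "\<lambda>i. i"])
  fix j assume j: "j \<in> J"
  have "{i \<in> I. i = j} = (if j \<in> I then {j} else {})" by auto
  then show "csums hs f {i \<in> I. i = j} (f j)"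
    using csums_finite[of "{j}" f] csums_finite[of "{}" f] j assms(3)[of j] by (auto split: if_splits)
qed (use assms(2) in auto)

text \<open>Summability of the subfamily comes from \<open>csums_block\<close>, \<open>I\<close>
  being a fibre of the membership predicate; extension by zero and uniqueness then identify its
  sum.\<close>

lemma csums_subset:
  assumes "csums hs f J s" "I \<subseteq> J" "\<And>j. j \<in> J - I \<Longrightarrow> f j = 0"
  shows "csums hs f I s"
proof -
  have "{i \<in> J. (i \<in> I) = True} = I" using assms(2) by auto
  then obtain u where u: "csums hs f I u"
    using csums_block[OF assms(1), of "\<lambda>i. i \<in> I" True] by auto
  then show ?thesis using csums_unique[OF csums_superset[OF u assms(2,3)] assms(1)] by simp
qed

lemma csums_finite_superset:
  assumes "finite I" "I \<subseteq> J" "\<And>j. j \<in> J - I \<Longrightarrow> f j = 0"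
  shows "csums hs f J (sum f I)"
  using csums_superset[OF csums_finite] assms by blast

lemma csums_0: "csums hs (\<lambda>_. 0) I 0"
  using csums_finite_superset[of "{}" I "\<lambda>_. 0"] by simp

text \<open>Regrouping along the inverse of \<open>h\<close> in one direction and along
  \<open>h\<close> in the other; all fibres are singletons.\<close>

lemma csums_image:
  fixes h :: "'i::countable \<Rightarrow> 'j::countable"
  assumes "inj_on h I"
  shows "csums hs f (h ` I) s \<longleftrightarrow> csums hs (\<lambda>i. f (h i)) I s"
proof
  assume *: "csums hs f (h ` I) s"
  show "csums hs (\<lambda>i. f (h i)) I s"
  proof (rule csums_regroup[OF *, of "inv_into I h"])
    fix i assume "i \<in> I"
    then have "{j \<in> h ` I. inv_into I h j = i} = {h i}" using assms by auto
    then show "csums hs f {j \<in> h ` I. inv_into I h j = i} (f (h i))"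
      using csums_finite[of "{h i}" f] by simp
  qed (use assms in auto)
next
  assume *: "csums hs (\<lambda>i. f (h i)) I s"
  show "csums hs f (h ` I) s"
  proof (rule csums_regroup[OF *, of h])
    fix j assume "j \<in> h ` I"
    then obtain i where i: "i \<in> I" "j = h i" by auto
    then have "{i \<in> I. h i = j} = {i}" using assms by (auto simp: inj_on_def)
    then show "csums hs (\<lambda>i. f (h i)) {i \<in> I. h i = j} (f j)"
      using csums_finite[of "{i}" "\<lambda>i. f (h i)"] i by simp
  qed simp
qed

lemma csums_sum:
  assumes "finite K" "\<And>k. k \<in> K \<Longrightarrow> csums hs (f k) I (s k)"
  shows "csums hs (\<lambda>i. \<Sum>k\<in>K. f k i) I (\<Sum>k\<in>K. s k)"
  using assms by (induction K) (simp_all add: csums_0 csums_add)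

text \<open>The terms with a fixed power of t form a fibre of the second projection, hence a
  summable block.\<close>

lemma tsummable_coeff:
  assumes "tsummable hs f I"
  shows "\<exists>s. csums hs (\<lambda>i. f i n) I s"
proof -
  obtain s where "csums hs (\<lambda>(i, n). f i n) (I \<times> UNIV) s" using assms by (auto simp: tsummable_def)
  then obtain u where "csums hs (\<lambda>(i, n). f i n) {i \<in> I \<times> UNIV. snd i = n} u"
    using csums_block by blast
  moreover have "{i \<in> I \<times> UNIV. snd i = n} = (\<lambda>i. (i, n)) ` I" by auto
  ultimately show ?thesis by (auto simp: csums_image inj_on_def)
qed

end

section \<open>Coefficients of multilinear expressions in power series\<close>

text \<open>Recursive form of \<open>poly_ext\<close>, suited to induction over the arguments.
  Coefficient sequences replace polynomials so that the output of an extended operation can again be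
  inserted as an argument.\<close>

fun seq_ext :: "('a list \<Rightarrow> 'v::comm_monoid_add) \<Rightarrow> (nat \<Rightarrow> 'a) list \<Rightarrow> nat \<Rightarrow> 'v" where
  "seq_ext f [] n = (if n = 0 then f [] else 0)"
| "seq_ext f (s # ss) n = (\<Sum>k\<le>n. seq_ext (\<lambda>ys. f (s k # ys)) ss (n - k))"

lemma finite_lists_sum_list: "finite {ns :: nat list. length ns = l \<and> sum_list ns = n}"
proof (rule finite_subset)
  show "{ns. length ns = l \<and> sum_list ns = n} \<subseteq> {ns. set ns \<subseteq> {..n} \<and> length ns = l}"
    using member_le_sum_list by fastforce
qed (simp add: finite_lists_length_eq)

lemma poly_ext_eq_seq_ext: "poly_ext f ps n = seq_ext f (map coeff ps) n"
proof (induction ps arbitrary: f n)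
  case Nil
  have "{ns :: nat list. ns = [] \<and> sum_list ns = n} = (if n = 0 then {[]} else {})" by auto
  then show ?case by (simp add: poly_ext_def)
next
  case (Cons p ps)
  let ?L = "\<lambda>l n. {ns :: nat list. length ns = l \<and> sum_list ns = n}"
  \<comment> \<open>A weak composition of \<open>n\<close> into \<open>Suc (length ps)\<close> parts
    is a first part \<open>k\<close> and a weak composition of \<open>n - k\<close>.\<close>
  have eq: "?L (Suc (length ps)) n = (\<lambda>(k, ns). k # ns) ` (SIGMA k:{..n}. ?L (length ps) (n - k))"
  proof (intro set_eqI iffI)
    fix ns assume "ns \<in> ?L (Suc (length ps)) n"
    then show "ns \<in> (\<lambda>(k, ns). k # ns) ` (SIGMA k:{..n}. ?L (length ps) (n - k))"
      by (cases ns) (auto simp: image_iff)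
  qed auto
  have "poly_ext f (p # ps) n
      = (\<Sum>(k, ns)\<in>(SIGMA k:{..n}. ?L (length ps) (n - k)). f (coeff p k # map2 coeff ps ns))"
    unfolding poly_ext_def list.size(4) One_nat_def add_Suc_right add_0_right eq
    by (subst sum.reindex) (auto simp: inj_on_def case_prod_unfold)
  also have "\<dots> = (\<Sum>k\<le>n. poly_ext (\<lambda>ys. f (coeff p k # ys)) ps (n - k))"
    unfolding poly_ext_def by (rule sum.Sigma[symmetric]) (simp_all add: finite_lists_sum_list)
  finally show ?case using Cons by simp
qed

text \<open>The structure relations are given on homogeneous arguments only. This suffices for
  series whose coefficients all have one degree.\<close>

lemma seq_ext_cong_homogeneous:
  assumes "list_all2 (\<lambda>s d. \<forall>k. s k \<in> G d) ss ds" "\<And>ys. homogeneous G ys ds \<Longrightarrow> f ys = g ys"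
  shows "seq_ext f ss n = seq_ext g ss n"
  using assms
proof (induction ss ds arbitrary: f g n rule: list_all2_induct)
  case Nil
  then show ?case by (simp add: homogeneous_def)
next
  case (Cons s ss d ds)
  have "seq_ext (\<lambda>ys. f (s k # ys)) ss n = seq_ext (\<lambda>ys. g (s k # ys)) ss n" for k n
    by (rule Cons.IH) (use Cons.hyps Cons.prems in \<open>auto simp: homogeneous_def\<close>)
  then show ?case by simp
qed

lemma seq_ext_cong:
  assumes "\<And>ys. length ys = length ss \<Longrightarrow> f ys = g ys"
  shows "seq_ext f ss n = seq_ext g ss n"
  \<comment> \<open>With every \<open>G d\<close> the whole space, homogeneity reduces to equality
    of lengths.\<close>
  by (rule seq_ext_cong_homogeneous[where G = "\<lambda>_. UNIV" and ds = "replicate (length ss) 0"])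
    (auto simp: list_all2_conv_all_nth homogeneous_def intro!: assms)

lemma seq_ext_0: "seq_ext (\<lambda>_. 0) ss n = 0"
  by (induction ss arbitrary: n) auto

lemma seq_ext_eq_0:
  assumes "\<And>ys. length ys = length ss \<Longrightarrow> f ys = 0"
  shows "seq_ext f ss n = 0"
  using seq_ext_cong[of ss f "\<lambda>_. 0"] assms by (simp add: seq_ext_0)

lemma seq_ext_add: "seq_ext (\<lambda>ys. f ys + g ys) ss n = seq_ext f ss n + seq_ext g ss n"
  by (induction ss arbitrary: f g n) (auto simp: sum.distrib)

lemma seq_ext_sum: "seq_ext (\<lambda>ys. \<Sum>i\<in>I. f i ys) ss n = (\<Sum>i\<in>I. seq_ext (f i) ss n)"
  by (induction I rule: infinite_finite_induct) (simp_all add: seq_ext_0 seq_ext_add)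

lemma (in vector_space) seq_ext_scale: "seq_ext (\<lambda>ys. scale r (f ys)) ss n = scale r (seq_ext f ss n)"
  by (induction ss arbitrary: f n) (auto simp: scale_sum_right)

lemma seq_ext_coeff_0: "seq_ext f ss 0 = f (map (\<lambda>s. s 0) ss)"
  by (induction ss arbitrary: f) auto

lemma seq_ext_snoc: "seq_ext f (ss @ [s]) n = (\<Sum>k\<le>n. seq_ext (\<lambda>ys. f (ys @ [s k])) ss (n - k))"
proof (induction ss arbitrary: f n)
  case Nil
  have "(\<Sum>k\<le>n. if n - k = 0 then f [s k] else 0) = (\<Sum>k\<le>n. if k = n then f [s k] else 0)"
    by (rule sum.cong) auto
  then show ?case by simp
next
  case (Cons r ss)
  have "seq_ext f ((r # ss) @ [s]) n
      = (\<Sum>k\<le>n. \<Sum>l\<le>n - k. seq_ext (\<lambda>ys. f (r k # ys @ [s l])) ss (n - k - l))"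
    using Cons by simp
  \<comment> \<open>The exponents \<open>k\<close> of the first and \<open>l\<close> of the last
    argument range over k + l \<le> n, which is symmetric.\<close>
  also have "\<dots> = (\<Sum>l\<le>n. \<Sum>k\<le>n - l. seq_ext (\<lambda>ys. f (r k # ys @ [s l])) ss (n - l - k))"
    unfolding sum.Sigma[OF finite_atMost ballI[OF finite_atMost]]
    by (rule sum.reindex_bij_witness[of _ prod.swap prod.swap]) (auto simp: add.commute)
  finally show ?case by simp
qed

text \<open>For the cancellation of m_2(x,I) against m_2(I,x), where x stands at opposite ends of
  the word.\<close>

lemma seq_ext_rotate: "seq_ext (\<lambda>ys. f (last ys # butlast ys)) (ss @ [s]) n = seq_ext f (s # ss) n"
  by (simp add: seq_ext_snoc)

section \<open>Multilinear maps and their composition\<close>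

lemma multilinear_Cons:
  assumes "multilinear sc sc' f"
  shows "multilinear sc sc' (\<lambda>ys. f (y # ys))"
  unfolding multilinear_def
proof (intro allI)
  fix us vs
  show "Vector_Spaces.linear sc sc' (\<lambda>x. f (y # us @ x # vs))"
    using assms[unfolded multilinear_def, THEN spec, THEN spec, of "y # us" vs] by simp
qed

lemma multilinear_sum:
  assumes "multilinear sc sc' f"
  shows "f (us @ sum h A # vs) = (\<Sum>a\<in>A. f (us @ h a # vs))"
proof -
  interpret Vector_Spaces.linear sc sc' "\<lambda>x. f (us @ x # vs)"
    using assms by (simp add: multilinear_def)
  show ?thesis by (rule sum)
qed

lemma multilinear_scale:
  assumes "multilinear sc sc' f"
  shows "f (us @ sc r x # vs) = sc' r (f (us @ x # vs))"
proof -
  interpret Vector_Spaces.linear sc sc' "\<lambda>x. f (us @ x # vs)"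
    using assms by (simp add: multilinear_def)
  show ?thesis by (rule scale)
qed

lemma multilinear_vector_space:
  assumes "multilinear sc sc' f"
  shows "vector_space sc'"
proof -
  interpret Vector_Spaces.linear sc sc' "\<lambda>x. f ([] @ x # [])"
    using assms unfolding multilinear_def by blast
  show ?thesis by (rule vs2.vector_space_axioms)
qed

lemma seq_ext_zero_entry:
  assumes "multilinear sc sc' f"
  shows "seq_ext f (us @ (\<lambda>_. 0) # ws) n = 0"
  using assms
proof (induction us arbitrary: f n)
  case Nil
  then have "f (0 # ys) = 0" for ys using multilinear_zero by force
  then show ?case by (simp add: seq_ext_0)
next
  case (Cons u us)
  show ?case using Cons.IH[OF multilinear_Cons[OF Cons.prems]] by simp
qed

lemma sum_atMost_nested:
  fixes g :: "nat \<Rightarrow> nat \<Rightarrow> 'v::comm_monoid_add"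
  shows "(\<Sum>n\<le>N. \<Sum>k\<le>n. g k (n - k)) = (\<Sum>k\<le>N. \<Sum>l\<le>N - k. g k l)"
proof -
  have "(\<Sum>(n, k)\<in>(SIGMA n:{..N}. {..n}). g k (n - k)) = (\<Sum>(k, l)\<in>(SIGMA k:{..N}. {..N - k}). g k l)"
    by (rule sum.reindex_bij_witness[of _ "\<lambda>(k, l). (k + l, k)" "\<lambda>(n, k). (k, n - k)"]) auto
  then show ?thesis by (simp add: sum.Sigma)
qed

text \<open>By multilinearity of \<open>f\<close>, the coefficients of the inner series can be
  collected before it is inserted. The \<open>take\<close> and \<open>drop\<close> pattern is the
  one in \<open>ainf_term\<close>.\<close>

lemma seq_ext_compose:
  assumes "multilinear sc sc' f"
  shows "seq_ext (\<lambda>ys. f (take (length us) ys @ g (take (length vs) (drop (length us) ys))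
             # drop (length us + length vs) ys)) (us @ vs @ ws) n
       = seq_ext f (us @ seq_ext g vs # ws) n"
  using assms
proof (induction us arbitrary: f n)
  case Nil
  show ?case
  proof (induction vs arbitrary: g n)
    case Nil
    \<comment> \<open>An empty inner word is the constant series \<open>g []\<close>; its higher
      coefficients are 0, and \<open>f\<close> vanishes on them.\<close>
    have "f (0 # ys) = 0" for ys
      using multilinear_zero[OF \<open>multilinear sc sc' f\<close>] by simp
    then have "seq_ext (\<lambda>ys. f ((if k = 0 then g [] else 0) # ys)) ws (n - k)
        = (if k = 0 then seq_ext (\<lambda>ys. f (g [] # ys)) ws n else 0)" for k
      by (simp add: seq_ext_0)
    then show ?case by simp
  next
    case (Cons v vs)
    have "seq_ext (\<lambda>ys. f (g (v k # take (length vs) ys) # drop (length vs) ys)) (vs @ ws) n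
        = (\<Sum>l\<le>n. seq_ext (\<lambda>ys. f (seq_ext (\<lambda>ys. g (v k # ys)) vs l # ys)) ws (n - l))" for k n
      using Cons[of "\<lambda>ys. g (v k # ys)" n] by simp
    then have "seq_ext (\<lambda>ys. f (g (take (Suc (length vs)) ys) # drop (Suc (length vs)) ys))
          ((v # vs) @ ws) n
        = (\<Sum>k\<le>n. \<Sum>l\<le>n - k. seq_ext (\<lambda>ys. f (seq_ext (\<lambda>ys. g (v k # ys)) vs l # ys)) ws (n - k - l))"
      by simp
    \<comment> \<open>Collect by h = k + l, the power of t carried by the output of
      \<open>g\<close>.\<close>
    also have "\<dots> = (\<Sum>h\<le>n. \<Sum>k\<le>h. seq_ext (\<lambda>ys. f (seq_ext (\<lambda>ys. g (v k # ys)) vs (h - k) # ys)) ws (n - h))"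
      using sum_atMost_nested[of "\<lambda>k l. seq_ext (\<lambda>ys. f (seq_ext (\<lambda>ys. g (v k # ys)) vs l # ys)) ws (n - k - l)" n]
      by simp
    also have "\<dots> = seq_ext f (seq_ext g (v # vs) # ws) n"
    proof -
      have "f (seq_ext g (v # vs) h # ys) = (\<Sum>k\<le>h. f (seq_ext (\<lambda>ys. g (v k # ys)) vs (h - k) # ys))" for h ys
        using multilinear_sum[OF \<open>multilinear sc sc' f\<close>, of "[]" "\<lambda>k. seq_ext (\<lambda>ys. g (v k # ys)) vs (h - k)" "{..h}" ys]
        by simp
      then show ?thesis by (simp only: seq_ext.simps(2)[of f] seq_ext_sum)
    qed
    finally show ?case by simp
  qed
next
  case (Cons u us)
  have "seq_ext (\<lambda>ys. f (u k # take (length us) ys @ g (take (length vs) (drop (length us) ys))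
             # drop (length us + length vs) ys)) (us @ vs @ ws) n
      = seq_ext (\<lambda>ys. f (u k # ys)) (us @ seq_ext g vs # ws) n" for k n
    by (rule Cons.IH[OF multilinear_Cons[OF Cons.prems, of "u k"]])
  then show ?case by simp
qed

lemma (in summation) seq_ext_csums:
  assumes "\<And>ys. csums hs (\<lambda>i. f i ys) I (g ys)"
  shows "csums hs (\<lambda>i. seq_ext (f i) ss n) I (seq_ext g ss n)"
  using assms by (induction ss arbitrary: f g n) (auto simp: csums_0 intro!: csums_sum)

text \<open>Only the finitely many coefficients of the inserted series up to \<open>n\<close> enter.
  The bound \<open>k \<le> n\<close> in the hypothesis is what later allows an induction over powers
  of t.\<close>

lemma (in summation) seq_ext_insert_csums:
  assumes "\<And>us vs h s. csums hs' h I s \<Longrightarrow> csums hs (\<lambda>i. f (us @ h i # vs)) I (f (us @ s # vs))"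
    and "\<And>k. k \<le> n \<Longrightarrow> csums hs' (\<lambda>i. g i k) I (y k)"
  shows "csums hs (\<lambda>i. seq_ext f (us @ g i # ws) n) I (seq_ext f (us @ y # ws) n)"
  using assms
proof (induction us arbitrary: f n)
  case Nil
  have "csums hs (\<lambda>i. f (g i k # ys)) I (f (y k # ys))" if "k \<le> n" for k ys
    using Nil.prems(1)[of "\<lambda>i. g i k" "y k" "[]" ys] Nil.prems(2)[OF that] by simp
  then show ?case by (auto intro!: csums_sum seq_ext_csums)
next
  case (Cons u us)
  have "csums hs (\<lambda>i. seq_ext (\<lambda>ys. f (u k # ys)) (us @ g i # ws) (n - k)) I
      (seq_ext (\<lambda>ys. f (u k # ys)) (us @ y # ws) (n - k))" for k
  proof (rule Cons.IH)
    show "csums hs (\<lambda>i. f (u k # us @ h i # vs)) I (f (u k # us @ s # vs))"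
      if "csums hs' h I s" for us vs h s
      using Cons.prems(1)[OF that, of "u k # us" vs] by simp
  qed (use Cons.prems in auto)
  then show ?case by (auto intro!: csums_sum)
qed

text \<open>The derivative of a series s has the coefficients (k + 1) s_(k+1), so this is the
  Leibniz rule read off at t^n.\<close>

lemma seq_ext_derivative:
  assumes "multilinear sc sc' f"
  shows "(\<Sum>i<length ss. seq_ext f (ss[i := \<lambda>k. sc (of_nat (Suc k)) ((ss ! i) (Suc k))]) n)
       = sc' (of_nat (Suc n)) (seq_ext f ss (Suc n))"
  using assms
proof (induction ss arbitrary: f n)
  case Nil
  interpret vector_space sc' using Nil by (rule multilinear_vector_space)
  show ?case by simp
next
  case (Cons s ss)
  interpret vector_space sc' using Cons.prems by (rule multilinear_vector_space)
  let ?D = "\<lambda>s k. sc (of_nat (Suc k)) (s (Suc k))"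
  let ?F = "\<lambda>k. seq_ext (\<lambda>ys. f (s k # ys)) ss"
  \<comment> \<open>The weight n + 1 splits into the exponent \<open>k\<close> of the head, which
    differentiates \<open>s\<close>, and the rest, which differentiates the tail. In each part the
    summand of weight 0 drops out.\<close>
  have "sc' (of_nat (Suc n)) (seq_ext f (s # ss) (Suc n))
      = (\<Sum>k\<le>Suc n. sc' (of_nat k + of_nat (Suc n - k)) (?F k (Suc n - k)))"
    by (simp only: seq_ext.simps scale_sum_right of_nat_add[symmetric])
      (rule sum.cong; simp)
  also have "\<dots> = (\<Sum>k\<le>Suc n. sc' (of_nat k) (?F k (Suc n - k)))
      + (\<Sum>k\<le>Suc n. sc' (of_nat (Suc n - k)) (?F k (Suc n - k)))"
    by (simp only: scale_left_distrib sum.distrib)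
  also have "(\<Sum>k\<le>Suc n. sc' (of_nat k) (?F k (Suc n - k)))
      = (\<Sum>k\<le>n. sc' (of_nat (Suc k)) (?F (Suc k) (n - k)))"
    by (subst sum.atMost_Suc_shift) simp
  also have "\<dots> = seq_ext f (?D s # ss) n"
    using multilinear_scale[OF Cons.prems, of "[]"] by (simp add: seq_ext_scale)
  also have "(\<Sum>k\<le>Suc n. sc' (of_nat (Suc n - k)) (?F k (Suc n - k)))
      = (\<Sum>k\<le>n. sc' (of_nat (Suc (n - k))) (?F k (Suc (n - k))))"
    by (simp add: Suc_diff_le del: of_nat_Suc of_nat_diff)
  also have "\<dots> = (\<Sum>k\<le>n. \<Sum>i<length ss. seq_ext (\<lambda>ys. f (s k # ys)) (ss[i := ?D (ss ! i)]) (n - k))"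
    using Cons.IH[OF multilinear_Cons[OF Cons.prems]] by simp
  also have "\<dots> = (\<Sum>i<length ss. seq_ext f (s # ss[i := ?D (ss ! i)]) n)"
    by (subst sum.swap) simp
  finally show ?case by (simp only: length_Cons sum.lessThan_Suc_shift) simp
qed

text \<open>With equal arguments the position of the derivative is recorded by (p, q), as in the
  gauge sums.\<close>

lemma seq_ext_replicate_derivative:
  assumes "multilinear sc sc' f" "y = (\<lambda>k. sc (of_nat (Suc k)) (x (Suc k)))"
  shows "(\<Sum>(p, q) | p + q = N. seq_ext f (replicate p x @ y # replicate q x) n)
       = sc' (of_nat (Suc n)) (seq_ext f (replicate (Suc N) x) (Suc n))"
proof -
  have "(\<Sum>(p, q) | p + q = N. seq_ext f (replicate p x @ y # replicate q x) n)
      = (\<Sum>p<Suc N. seq_ext f (replicate p x @ y # replicate (N - p) x) n)"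
    by (rule sum.reindex_bij_witness[of _ "\<lambda>p. (p, N - p)" fst]) auto
  also have "\<dots> = (\<Sum>p<Suc N. seq_ext f ((replicate (Suc N) x)[p := y]) n)"
  proof (rule sum.cong)
    fix p assume "p \<in> {..<Suc N}"
    then obtain q where "N = p + q" by (auto simp: less_Suc_eq_le le_iff_add)
    then have "replicate (Suc N) x = replicate p x @ x # replicate (N - p) x"
      by (simp add: replicate_add replicate_app_Cons_same)
    then have "(replicate (Suc N) x)[p := y] = replicate p x @ y # replicate (N - p) x"
      by (simp add: list_update_append)
    then show "seq_ext f (replicate p x @ y # replicate (N - p) x) n
        = seq_ext f ((replicate (Suc N) x)[p := y]) n" by simp
  qed simp
  also have "\<dots> = (\<Sum>p<Suc N. seq_ext f ((replicate (Suc N) x)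
      [p := \<lambda>k. sc (of_nat (Suc k)) ((replicate (Suc N) x ! p) (Suc k))]) n)"
    by (rule sum.cong) (simp_all only: assms(2) nth_replicate lessThan_iff)
  also have "\<dots> = sc' (of_nat (Suc n)) (seq_ext f (replicate (Suc N) x) (Suc n))"
    using seq_ext_derivative[OF assms(1), of "replicate (Suc N) x" n] by (simp only: length_replicate)
  finally show ?thesis .
qed

text \<open>Adding up all coefficients evaluates at t = 1; \<open>d\<close> bounds the degrees of
  the arguments.\<close>

lemma seq_ext_total:
  assumes "multilinear sc sc' f" "\<And>s k. s \<in> set ss \<Longrightarrow> k > d \<Longrightarrow> s k = 0" "D \<ge> d * length ss"
  shows "(\<Sum>n\<le>D. seq_ext f ss n) = f (map (\<lambda>s. \<Sum>k\<le>d. s k) ss)"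
  using assms
proof (induction ss arbitrary: f D)
  case (Cons s ss)
  let ?T = "map (\<lambda>s. \<Sum>k\<le>d. s k) ss"
  have "(\<Sum>n\<le>D. seq_ext f (s # ss) n) = (\<Sum>k\<le>D. \<Sum>l\<le>D - k. seq_ext (\<lambda>ys. f (s k # ys)) ss l)"
    by (simp add: sum_atMost_nested[where g = "\<lambda>k. seq_ext (\<lambda>ys. f (s k # ys)) ss"])
  also have "\<dots> = (\<Sum>k\<le>d. \<Sum>l\<le>D - k. seq_ext (\<lambda>ys. f (s k # ys)) ss l)"
    using Cons.prems(2,3) multilinear_zero[OF Cons.prems(1)]
    by (intro sum.mono_neutral_right) (auto simp: seq_ext_eq_0)
  also have "\<dots> = (\<Sum>k\<le>d. f (s k # ?T))"
  proof (rule sum.cong)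
    fix k assume "k \<in> {..d}"
    then have "d * length ss \<le> D - k" using Cons.prems(3) by simp
    then show "(\<Sum>l\<le>D - k. seq_ext (\<lambda>ys. f (s k # ys)) ss l) = f (s k # ?T)"
      using Cons.IH[OF multilinear_Cons[OF Cons.prems(1)]] Cons.prems(2) by simp
  qed simp
  also have "\<dots> = f ((\<Sum>k\<le>d. s k) # ?T)"
    using multilinear_sum[OF Cons.prems(1), of "[]" s "{..d}" ?T] by simp
  finally show ?case by simp
qed simp

lemma (in summation) seq_ext_total_csums:
  assumes "multilinear sc' sc f" "\<And>s k. s \<in> set ss \<Longrightarrow> k > d \<Longrightarrow> s k = 0"
  shows "csums hs (seq_ext f ss) UNIV (f (map (\<lambda>s. \<Sum>k\<le>d. s k) ss))"
proof -
  have total: "(\<Sum>n\<le>D. seq_ext f ss n) = f (map (\<lambda>s. \<Sum>k\<le>d. s k) ss)" if "D \<ge> d * length ss" for D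
    by (rule seq_ext_total[OF assms(1) _ that]) (rule assms(2))
  \<comment> \<open>The partial sums are constant from \<open>d * length ss\<close> on, so each
    later coefficient, a difference of two of them, vanishes.\<close>
  have "seq_ext f ss n = 0" if "n > d * length ss" for n
  proof (cases n)
    case (Suc k)
    then show ?thesis using total[of n] total[of k] that by simp
  qed (use that in simp)
  then have "csums hs (seq_ext f ss) UNIV (\<Sum>n\<le>d * length ss. seq_ext f ss n)"
    by (intro csums_finite_superset) auto
  then show ?thesis using total[of "d * length ss"] by simp
qed

section \<open>Insertion of the gauge equation\<close>

lemma sdeg_append: "sdeg (ds @ ds') = sdeg ds + sdeg ds'"
  by (simp add: sdeg_def)

lemma sdeg_Cons: "sdeg (d # ds) = d - 1 + sdeg ds"
  by (simp add: sdeg_def)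

lemma sdeg_Nil: "sdeg [] = 0"
  by (simp add: sdeg_def)

text \<open>Entries of x(t) have shifted degree 0, so only c(t) and the unit, of shifted degree -1,
  can contribute to signs.\<close>

lemma sdeg_replicate_1: "sdeg (replicate n 1) = 0"
  by (simp add: sdeg_def sum_list_replicate)

lemma (in summation) csums_zero_blocks:
  fixes \<pi> :: "'i::countable \<Rightarrow> 'j::countable"
  assumes "csums hs f I s" "\<And>j. csums hs f {i \<in> I. \<pi> i = j} 0"
  shows "s = 0"
proof -
  have "csums hs (\<lambda>_ :: 'j. 0) UNIV s"
    by (rule csums_regroup[OF assms(1), of \<pi>]) (simp_all add: assms(2))
  then show ?thesis using csums_0 csums_unique by blast
qed

lemma antidiagonal_eq: "{(p, q). p + q = N} = (\<lambda>p. (p, N - p)) ` {..N}" for N :: nat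
  by force

lemma (in summation) csums_derivative:
  assumes "multilinear sc' sc f" "y = (\<lambda>k. sc' (of_nat (Suc k)) (x (Suc k)))"
  shows "csums hs (\<lambda>(p, q). seq_ext f (replicate p x @ y # replicate q x) n) {(p, q). p + q = N}
    (sc (of_nat (Suc n)) (seq_ext f (replicate (Suc N) x) (Suc n)))"
proof -
  have "finite {(p, q). p + q = N}" unfolding antidiagonal_eq by simp
  from csums_finite[OF this] show ?thesis
    unfolding seq_ext_replicate_derivative[OF assms, symmetric] .
qed

text \<open>
  The terms in which \<open>m\<close> receives \<open>c(t)\<close> add up to those with \<open>x'(t)\<close> inserted; the others contain a
  Maurer--Cartan sum of \<open>x(t)\<close>.
\<close>

lemma (in summation) csums_insert_gauge:
  fixes f :: "'a::ab_group_add list \<Rightarrow> 'v" and m :: "'a list \<Rightarrow> 'a" and c x y :: "nat \<Rightarrow> 'a"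
  assumes f: "multilinear sc' sc f"
    and insert: "\<And>us vs h N s. hs' h N s \<Longrightarrow> hs (\<lambda>i. f (us @ h i # vs)) N (f (us @ s # vs))"
    and total: "csums hs (\<lambda>(p, q, i, j). seq_ext
        (\<lambda>ys. sc ((-1) powi sdeg (take i (replicate p 1 @ 0 # replicate q 1)))
          (f (take i ys @ m (take j (drop i ys)) # drop (i + j) ys)))
        (replicate p x @ c # replicate q x) n)
      {(p, q, i, j). 1 \<le> j \<and> i + j \<le> p + q + 1} S"
    and MC: "\<And>k. k \<le> n \<Longrightarrow> csums hs' (\<lambda>j. seq_ext m (replicate j x) k) {1..} 0"
    and gauge: "\<And>k. k \<le> n \<Longrightarrow>
      csums hs' (\<lambda>(r, s). seq_ext m (replicate r x @ c # replicate s x) k) UNIV (y k)"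
  shows "csums hs (\<lambda>(p, q). seq_ext f (replicate p x @ y # replicate q x) n) UNIV S"
proof -
  define T where "T = (\<lambda>(p, q, i, j). seq_ext
        (\<lambda>ys. sc ((-1) powi sdeg (take i (replicate p 1 @ 0 # replicate q 1)))
          (f (take i ys @ m (take j (drop i ys)) # drop (i + j) ys)))
        (replicate p x @ c # replicate q x) n)"
  define I :: "(nat \<times> nat \<times> nat \<times> nat) set" where "I = {(p, q, i, j). 1 \<le> j \<and> i + j \<le> p + q + 1}"
  have T_total: "csums hs T I S" using total by (simp only: T_def I_def)
  have T: "T (p, q, i, j) = sc ((-1) powi sdeg (take i (replicate p 1 @ 0 # replicate q 1)))
      (seq_ext f (us @ seq_ext m vs # ws) n)"
    if "replicate p x @ c # replicate q x = us @ vs @ ws" "i = length us" "j = length vs"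
    for p q i j us vs ws
    unfolding T_def prod.case seq_ext_scale that by (simp only: seq_ext_compose[OF f])
  \<comment> \<open>A string before or around c(t) has only copies of x(t) to its left, so its sign
    is 1; a string after c(t) gets (-1)^(-1) = -1.\<close>
  have Tleft: "T (i + j + k, q, i, j)
      = seq_ext f (replicate i x @ seq_ext m (replicate j x) # replicate k x @ c # replicate q x) n"
    for i j k q
    by (subst T[of _ _ "replicate i x" "replicate j x" "replicate k x @ c # replicate q x"])
      (simp_all add: replicate_add sdeg_replicate_1)
  have Tmid: "T (P + r, s + Q, P, Suc (r + s))
      = seq_ext f (replicate P x @ seq_ext m (replicate r x @ c # replicate s x) # replicate Q x) n"
    for P r s Q
    by (subst T[of _ _ "replicate P x" "replicate r x @ c # replicate s x" "replicate Q x"])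
      (simp_all add: replicate_add sdeg_replicate_1)
  have Tright: "T (p, k + j + l, Suc (p + k), j)
      = sc (- 1) (seq_ext f ((replicate p x @ c # replicate k x)
          @ seq_ext m (replicate j x) # replicate l x) n)"
    for p k j l
    by (subst T[of _ _ "replicate p x @ c # replicate k x" "replicate j x" "replicate l x"])
      (simp_all add: replicate_add sdeg_append sdeg_Cons sdeg_replicate_1)
  have ins: "csums hs (\<lambda>i. seq_ext f (us @ g i # ws) n) J (seq_ext f (us @ z # ws) n)"
    if "\<And>k. k \<le> n \<Longrightarrow> csums hs' (\<lambda>i. g i k) J (z k)"
    for us ws z and J :: "'j::countable set" and g
    by (rule seq_ext_insert_csums[where hs' = hs']) (use insert that in \<open>auto simp: csums_def\<close>)
  \<comment> \<open>\<open>\<pi>\<close> keeps the outer word and forgets how the string is filled.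
    The fibres over \<open>Inl\<close> are gauge sums, those over \<open>Inr\<close> are
    Maurer-Cartan sums with the string left or right of c(t).\<close>
  define \<pi> :: "nat \<times> nat \<times> nat \<times> nat \<Rightarrow> nat \<times> nat + nat \<times> nat \<times> nat + nat \<times> nat \<times> nat"
    where "\<pi> = (\<lambda>(p, q, i, j).
      if i + j \<le> p then Inr (Inl (i, p - (i + j), q))
      else if i \<le> p then Inl (i, p + q + 1 - (i + j))
      else Inr (Inr (p, i - Suc p, p + q + 1 - (i + j))))"
  let ?u = "case_sum (\<lambda>(p, q). seq_ext f (replicate p x @ y # replicate q x) n)
      (\<lambda>_ :: nat \<times> nat \<times> nat + nat \<times> nat \<times> nat. 0)"
  have "csums hs ?u UNIV S"
  proof (rule csums_regroup[OF T_total, of \<pi>])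
    fix z :: "nat \<times> nat + nat \<times> nat \<times> nat + nat \<times> nat \<times> nat"
    consider (mid) P Q where "z = Inl (P, Q)" | (left) i k q where "z = Inr (Inl (i, k, q))"
      | (right) p k l where "z = Inr (Inr (p, k, l))"
      by (metis sumE prod_cases3 surj_pair)
    then show "csums hs T {t \<in> I. \<pi> t = z} (?u z)"
    proof cases
      case mid
      have "{t \<in> I. \<pi> t = z} = (\<lambda>(r, s). (P + r, s + Q, P, Suc (r + s))) ` UNIV"
      proof (intro set_eqI iffI)
        fix t assume "t \<in> {t \<in> I. \<pi> t = z}"
        then obtain p q i j where "t = (p, q, i, j)" "i \<le> p" "p < i + j" "i + j \<le> p + q + 1"
          "P = i" "Q = p + q + 1 - (i + j)"
          by (cases t) (auto simp: I_def \<pi>_def mid split: if_splits)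
        then have "t = (\<lambda>(r, s). (P + r, s + Q, P, Suc (r + s))) (p - i, i + j - Suc p)" by auto
        then show "t \<in> (\<lambda>(r, s). (P + r, s + Q, P, Suc (r + s))) ` UNIV" by blast
      qed (auto simp: I_def \<pi>_def mid)
      moreover have "inj (\<lambda>(r, s). (P + r, s + Q, P, Suc (r + s)))" by (auto simp: inj_on_def)
      moreover have "csums hs (\<lambda>(r, s). T (P + r, s + Q, P, Suc (r + s))) UNIV (?u z)"
        using ins[of "\<lambda>(r, s). seq_ext m (replicate r x @ c # replicate s x)" UNIV y] gauge
        by (simp add: Tmid mid case_prod_unfold)
      ultimately show ?thesis by (simp add: csums_image case_prod_unfold)
    next
      case left
      have "{t \<in> I. \<pi> t = z} = (\<lambda>j. (i + j + k, q, i, j)) ` {1..}"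
        by (auto simp: I_def \<pi>_def left image_iff split: if_splits)
      moreover have "csums hs (\<lambda>j. T (i + j + k, q, i, j)) {1..} (?u z)"
        using ins[of "\<lambda>j. seq_ext m (replicate j x)" "{1..}" "\<lambda>_. 0"] MC
        by (simp add: Tleft left seq_ext_zero_entry[OF f])
      ultimately show ?thesis by (simp add: csums_image inj_on_def)
    next
      case right
      have "{t \<in> I. \<pi> t = z} = (\<lambda>j. (p, k + j + l, Suc (p + k), j)) ` {1..}"
        by (auto simp: I_def \<pi>_def right image_iff split: if_splits)
      moreover have "csums hs (\<lambda>j. T (p, k + j + l, Suc (p + k), j)) {1..} (sc (- 1) 0)"
        unfolding Tright using ins[of "\<lambda>j. seq_ext m (replicate j x)" "{1..}" "\<lambda>_. 0"] MC
        by (intro csums_scale) (metis seq_ext_zero_entry[OF f])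
      ultimately show ?thesis by (simp add: csums_image inj_on_def right)
    qed
  qed simp
  \<comment> \<open>The Maurer-Cartan blocks have sum 0 and are discarded.\<close>
  then have "csums hs ?u (range Inl) S"
    by (rule csums_subset) (auto split: sum.splits)
  then show ?thesis by (simp add: csums_image case_prod_unfold)
qed

section \<open>Gauge paths\<close>

lemma homogeneous_append:
  "homogeneous G xs ds \<Longrightarrow> homogeneous G ys es \<Longrightarrow> homogeneous G (xs @ ys) (ds @ es)"
  by (simp add: homogeneous_def list_all2_appendI)

lemma homogeneous_take: "homogeneous G xs ds \<Longrightarrow> homogeneous G (take i xs) (take i ds)"
  by (simp add: homogeneous_def)

lemma homogeneous_drop: "homogeneous G xs ds \<Longrightarrow> homogeneous G (drop i xs) (drop i ds)"
  by (simp add: homogeneous_def)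

lemma homogeneous_nth: "homogeneous G xs ds \<Longrightarrow> i < length xs \<Longrightarrow> xs ! i \<in> G (ds ! i)"
  by (simp add: homogeneous_def list_all2_conv_all_nth)

lemma homogeneous_length: "homogeneous G xs ds \<Longrightarrow> length ds = length xs"
  by (simp add: homogeneous_def list_all2_lengthD)

text \<open>Needed to apply \<open>\<phi>_unit_position\<close> to words into which an operation has
  been inserted; the new degree comes from \<open>m_degree\<close>.\<close>

lemma (in a_infinity_algebra) homogeneous_insert_m:
  assumes "homogeneous G ys ds" "1 \<le> j" "i + j \<le> length ys"
  shows "\<exists>es. homogeneous G (take i ys @ m (take j (drop i ys)) # drop (i + j) ys) es"
proof -
  have "m (take j (drop i ys)) \<in> G (sdeg (take j (drop i ds)) + 2)"
    using assms by (intro m_degree homogeneous_take homogeneous_drop) auto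
  then have "homogeneous G (m (take j (drop i ys)) # drop (i + j) ys)
      ((sdeg (take j (drop i ds)) + 2) # drop (i + j) ds)"
    using homogeneous_drop[OF assms(1)] by (simp add: homogeneous_def)
  then show ?thesis using homogeneous_append homogeneous_take[OF assms(1)] by blast
qed

lemma homogeneous_replicate_coeffs:
  assumes "\<And>k. x k \<in> G 1" "\<And>k. c k \<in> G d"
  shows "list_all2 (\<lambda>s d. \<forall>k. s k \<in> G d) (replicate p x @ c # replicate q x)
    (replicate p 1 @ d # replicate q 1)"
proof -
  have "list_all2 (\<lambda>s d. \<forall>k. s k \<in> G d) (replicate r x) (replicate r 1)" for r
    using assms(1) by (simp add: list_all2_conv_all_nth)
  then show ?thesis using assms(2) by (simp add: list_all2_appendI)
qed

lemma finite_subwords: "finite {(i, j :: nat). 1 \<le> j \<and> i + j \<le> N}"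
  by (rule finite_subset[of _ "{..N} \<times> {..N}"]) auto

locale gauge_setting = unital_a_infinity_algebra sc G m e + strong_homotopy_inner_product sc G m \<phi>
    + sums: summation_in_operations sc hsA hsK m \<phi>
  for sc :: "'k::field_char_0 \<Rightarrow> 'a::ab_group_add \<Rightarrow> 'a" and G m e \<phi> hsA hsK +
  assumes unital: "unital_bimodule_map sc e \<phi>"
begin

section \<open>The pairing with the unit\<close>

text \<open>Taking the first entry as bimodule entry is a mere choice on homogeneous words, by
  \<open>\<phi>_unit_position\<close>. A multilinear function of one list is the form that
  \<open>csums_insert_gauge\<close> requires.\<close>

definition unit_pairing :: "'a list \<Rightarrow> 'k"
  where "unit_pairing ys = \<phi> [] (hd ys) (tl ys) e"

lemma multilinear_unit_pairing: "multilinear sc (*) unit_pairing"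
  unfolding multilinear_def
proof (intro allI)
  fix us vs :: "'a list"
  show "Vector_Spaces.linear sc (*) (\<lambda>x. unit_pairing (us @ x # vs))"
    using linear_bimodule_entry linear_right
    by (cases us) (auto simp: unit_pairing_def multilinear_def)
qed

lemma insert_unit_pairing:
  "hsA h N s \<Longrightarrow> hsK (\<lambda>i. unit_pairing (us @ h i # vs)) N (unit_pairing (us @ s # vs))"
  using sums.insert_bimodule_entry sums.insert_right by (cases us) (auto simp: unit_pairing_def)

lemma \<phi>_unit_side: "e \<in> set a \<union> set b \<Longrightarrow> \<phi> a v b w = 0"
  using unital scale_one unfolding unital_bimodule_map_def by metis

text \<open>
  Closedness for \<open>y\<^sub>0, \<dots>, y\<^sub>n, I\<close> at the positions of \<open>y\<^sub>0\<close>, \<open>y\<^sub>p\<close> and \<open>I\<close>: the bracket without \<open>I\<close>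
  vanishes by unitality, and skew symmetry compares the other two.
\<close>

lemma \<phi>_unit_position:
  assumes "homogeneous G (a @ v # b) ds"
  shows "\<phi> a v b e = unit_pairing (a @ v # b)"
proof (cases a)
  case Nil
  then show ?thesis by (simp add: unit_pairing_def)
next
  case (Cons u a')
  define zs where "zs = a' @ v # b"
  obtain d es where ds: "ds = d # es" and u: "u \<in> G d" and zs: "homogeneous G zs es"
    using assms by (auto simp: Cons homogeneous_def zs_def list_all2_Cons1)
  define xs where "xs = u # zs @ [e]"
  have len: "length es = length zs" by (rule homogeneous_length[OF zs])
  have hom: "homogeneous G xs (d # es @ [0])"
    using zs u unit_degree by (auto simp: xs_def homogeneous_def intro: list_all2_appendI)
  have xs: "xs = a @ v # b @ [e]" by (simp add: xs_def zs_def Cons)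
  define p where "p = length a"
  define n where "n = Suc (length zs)"
  have n: "n = Suc (length a + length b)" by (simp add: n_def zs_def Cons)
  have "bracket \<phi> (d # es @ [0]) xs 0 p + bracket \<phi> (d # es @ [0]) xs p n
      + bracket \<phi> (d # es @ [0]) xs n 0 = 0"
    by (rule closedness[OF hom]) (simp_all add: p_def n Cons xs)
  \<comment> \<open>Here \<open>I\<close> is among the side entries.\<close>
  moreover have "bracket \<phi> (d # es @ [0]) xs 0 p = 0"
    unfolding bracket_def by (simp add: \<phi>_unit_side xs p_def)
  \<comment> \<open>Rotation by the whole word is trivial, so the sign is 1.\<close>
  moreover have "bracket \<phi> (d # es @ [0]) xs p n = \<phi> a v b e"
    unfolding bracket_def using len n by (simp add: xs p_def n_def nth_append sdeg_Nil)
  \<comment> \<open>The Koszul sign of this rotation, \<open>I\<close> having shifted degree -1,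
    agrees with the one in the skew symmetry below; hence this bracket is
    \<open>- \<phi> [] u zs e\<close>.\<close>
  moreover have "bracket \<phi> (d # es @ [0]) xs n 0 = (- 1) powi ((d - 1) * (sdeg es - 1)) * \<phi> zs e [] u"
    unfolding bracket_def using len
    by (simp add: xs_def n_def sdeg_append sdeg_Cons sdeg_Nil)
  moreover have "\<phi> [] u zs e = - ((- 1) powi ((d - 1) * (sdeg es - 1))) * \<phi> zs e [] u"
    using skew_symmetry[of "[]" "[]" u d zs es e 0] u zs unit_degree
    by (simp add: homogeneous_def sdeg_Nil)
  ultimately have "\<phi> a v b e = \<phi> [] u zs e" by (simp add: add_eq_0_iff2)
  then show ?thesis by (simp add: unit_pairing_def Cons zs_def)
qed

lemma \<phi>_unit_split:
  assumes "homogeneous G ys ds" "p < length ys"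
  shows "\<phi> (take p ys) (ys ! p) (drop (Suc p) ys) e = unit_pairing ys"
proof -
  have ys: "ys = take p ys @ ys ! p # drop (Suc p) ys" using assms(2) by (rule id_take_nth_drop)
  show ?thesis using \<phi>_unit_position[of "take p ys" "ys ! p" "drop (Suc p) ys" ds] assms(1) ys by simp
qed

text \<open>Once \<open>m\<close> has been applied, the three cases of \<open>bimod_term1\<close>
  differ only in where the bimodule entry stands, and \<open>\<phi>_unit_position\<close> makes this
  irrelevant.\<close>

lemma bimod_term1_unit:
  assumes "homogeneous G ys (replicate p 1 @ 0 # replicate q 1)" "1 \<le> j" "i + j \<le> p + q + 1"
  shows "bimod_term1 m \<phi> (replicate p 1) 0 (replicate q 1) (take p ys) (ys ! p) (drop (Suc p) ys) e i j
    = (- 1) powi sdeg (take i (replicate p 1 @ 0 # replicate q 1))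
      * unit_pairing (take i ys @ m (take j (drop i ys)) # drop (i + j) ys)"
proof -
  have len: "length ys = p + q + 1" using homogeneous_length[OF assms(1)] by simp
  define a v b where "a = take p ys" and "v = ys ! p" and "b = drop (Suc p) ys"
  have ys: "ys = a @ v # b" unfolding a_def v_def b_def by (rule id_take_nth_drop) (simp add: len)
  have p: "length a = p" by (simp add: a_def len)
  obtain es where es: "homogeneous G (take i ys @ m (take j (drop i ys)) # drop (i + j) ys) es"
    using homogeneous_insert_m[OF assms(1,2)] assms(3) len by auto
  consider "i + j \<le> p" | "i \<le> p" "p < i + j" | "p < i" by linarith
  then show ?thesis
    unfolding a_def[symmetric] v_def[symmetric] b_def[symmetric]
  proof cases
    case 1
    then have "take i ys @ m (take j (drop i ys)) # drop (i + j) ys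
        = (take i a @ m (take j (drop i a)) # drop (i + j) a) @ v # b"
      by (simp add: ys p)
    then show "bimod_term1 m \<phi> (replicate p 1) 0 (replicate q 1) a v b e i j
        = (- 1) powi sdeg (take i (replicate p 1 @ 0 # replicate q 1))
          * unit_pairing (take i ys @ m (take j (drop i ys)) # drop (i + j) ys)"
      using es 1 \<phi>_unit_position by (simp add: bimod_term1_def p)
  next
    case 2
    \<comment> \<open>\<open>k\<close> is the number of entries of the string to the right of
      \<open>v\<close>.\<close>
    obtain k where "i + j = Suc (p + k)" using 2 less_imp_Suc_add by blast
    moreover from this 2 have "j = (p - i) + Suc k" by simp
    ultimately have "take i ys @ m (take j (drop i ys)) # drop (i + j) ys
        = take i a @ m (drop i a @ v # take (i + j - p - 1) b) # drop (i + j - p - 1) b"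
      using 2 by (simp add: ys p)
    then show "bimod_term1 m \<phi> (replicate p 1) 0 (replicate q 1) a v b e i j
        = (- 1) powi sdeg (take i (replicate p 1 @ 0 # replicate q 1))
          * unit_pairing (take i ys @ m (take j (drop i ys)) # drop (i + j) ys)"
      using es 2 \<phi>_unit_position by (simp add: bimod_term1_def p)
  next
    case 3
    then obtain k where "i = Suc (p + k)" using less_imp_Suc_add by blast
    then have "take i ys @ m (take j (drop i ys)) # drop (i + j) ys
        = a @ v # (take (i - p - 1) b @ m (take j (drop (i - p - 1) b)) # drop (i - p - 1 + j) b)"
      by (simp add: ys p)
    then show "bimod_term1 m \<phi> (replicate p 1) 0 (replicate q 1) a v b e i j
        = (- 1) powi sdeg (take i (replicate p 1 @ 0 # replicate q 1))
          * unit_pairing (take i ys @ m (take j (drop i ys)) # drop (i + j) ys)"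
      using es 3 \<phi>_unit_position by (simp add: bimod_term1_def p)
  qed
qed

section \<open>The second sum of the bimodule relations\<close>

lemma \<phi>_dual_zero: "\<phi> a v b 0 = 0"
  by (rule linear_map_zero[OF linear_dual_entry])

lemma \<phi>_dual_neg: "\<phi> a v b (- w) = - \<phi> a v b w"
proof -
  interpret Vector_Spaces.linear sc "(*)" "\<phi> a v b" by (rule linear_dual_entry)
  show ?thesis by (rule neg)
qed

lemma m_degree_1_unit: "y \<in> G 1 \<Longrightarrow> m [y, e] = - y"
  using unit_right[of y 1] by (simp add: minus_equation_iff)

text \<open>Since \<open>m\<^sub>2(I, x) = x = - m\<^sub>2(x, I)\<close>, the terms of the second sum cancel in pairs.\<close>

lemma bimod_term2_unit_sum:
  assumes x: "\<And>k. x k \<in> G 1" and c: "\<And>k. c k \<in> G 0"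
    and S: "csums hsK (\<lambda>(p, q, i, j). seq_ext
        (\<lambda>ys. bimod_term2 m \<phi> (replicate p 1) 0 (replicate q 1) 0
                (take p ys) (ys ! p) (drop (Suc p) ys) e i j)
        (replicate p x @ c # replicate q x) n)
      {(p, q, i, j). i \<le> p \<and> j \<le> q} S"
  shows "S = 0"
\<comment> \<open>Group by the side entries that stay in \<open>\<phi>\<close>: \<open>p - i\<close>
  before c(t) and \<open>j\<close> after it.\<close>
proof (rule sums.K.csums_zero_blocks[OF S, of "\<lambda>(p, q, i, j). (p - i, j)"])
  define T where "T = (\<lambda>(p, q, i, j). seq_ext
        (\<lambda>ys. bimod_term2 m \<phi> (replicate p 1) 0 (replicate q 1) 0
                (take p ys) (ys ! p) (drop (Suc p) ys) e i j)
        (replicate p x @ c # replicate q x) n)"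
  fix PQ :: "nat \<times> nat"
  obtain P Q where PQ: "PQ = (P, Q)" by (cases PQ)
  let ?g = "\<lambda>ys. \<phi> (take P ys) (ys ! P) (drop (Suc P) ys)"
  let ?E = "seq_ext (\<lambda>ys. ?g (butlast ys) (last ys)) ((replicate P x @ c # replicate Q x) @ [x]) n"
  note hom = homogeneous_replicate_coeffs[of x G c 0, OF x c]
  \<comment> \<open>m_2(x,I) = -x meets the sign -1 that c(t) contributes, so this term is
    \<open>?E\<close>.\<close>
  have "T (P, Suc Q, 0, Q) = seq_ext (\<lambda>ys. ?g (butlast ys) (last ys)) (replicate P x @ c # replicate (Suc Q) x) n"
    unfolding T_def prod.case
  proof (rule seq_ext_cong_homogeneous[OF hom])
    fix ys assume ys: "homogeneous G ys (replicate P 1 @ 0 # replicate (Suc Q) 1)"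
    then have len: "length ys = Suc (P + Suc Q)" using homogeneous_length by fastforce
    then obtain zs y where zs: "ys = zs @ [y]" "length zs = P + Suc Q"
      by (metis length_Suc_conv_rev)
    have "y \<in> G 1" using homogeneous_nth[OF ys, of "P + Suc Q"] zs by (simp add: nth_append del: replicate_Suc)
    then show "bimod_term2 m \<phi> (replicate P 1) 0 (replicate (Suc Q) 1) 0
          (take P ys) (ys ! P) (drop (Suc P) ys) e 0 Q = ?g (butlast ys) (last ys)"
      using zs by (simp add: bimod_term2_def m_degree_1_unit \<phi>_dual_neg nth_append
          sdeg_Nil sdeg_replicate_1 del: replicate_Suc)
  qed
  then have T1: "T (P, Suc Q, 0, Q) = ?E" by (simp add: replicate_append_same)
  \<comment> \<open>Here m_2(I,x) = x, so the sign -1 of c(t) survives; a rotation of the arguments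
    then gives \<open>- ?E\<close>.\<close>
  have "T (Suc P, Q, 1, Q) = seq_ext (\<lambda>ys. - ?g (tl ys) (hd ys)) (replicate (Suc P) x @ c # replicate Q x) n"
    unfolding T_def prod.case
  proof (rule seq_ext_cong_homogeneous[OF hom])
    fix ys assume ys: "homogeneous G ys (replicate (Suc P) 1 @ 0 # replicate Q 1)"
    then have len: "length ys = Suc (P + Suc Q)" using homogeneous_length by fastforce
    then obtain y zs where zs: "ys = y # zs" "length zs = P + Suc Q"
      by (auto simp: length_Suc_conv)
    show "bimod_term2 m \<phi> (replicate (Suc P) 1) 0 (replicate Q 1) 0
          (take (Suc P) ys) (ys ! Suc P) (drop (Suc (Suc P)) ys) e 1 Q = - ?g (tl ys) (hd ys)"
      using zs by (simp add: bimod_term2_def unit_left sdeg_Cons sdeg_Nil sdeg_replicate_1)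
  qed
  also have "\<dots> = - seq_ext (\<lambda>ys. ?g (tl ys) (hd ys)) (replicate (Suc P) x @ c # replicate Q x) n"
    using sums.K.seq_ext_scale[of "- 1" "\<lambda>ys. ?g (tl ys) (hd ys)"] by simp
  also have "\<dots> = - ?E"
    using seq_ext_rotate[of "\<lambda>ys. ?g (tl ys) (hd ys)" "replicate P x @ c # replicate Q x" x n] by simp
  finally have T2: "T (Suc P, Q, 1, Q) = - ?E" .
  \<comment> \<open>The operation receives \<open>q - j + i\<close> entries besides
    \<open>I\<close>, so it vanishes unless it is m_2.\<close>
  have T0: "T (p, q, i, j) = 0" if "q - j + i \<noteq> 1" "i \<le> p" "j \<le> q" for p q i j
    unfolding T_def prod.case
  proof (rule seq_ext_eq_0)
    fix ys :: "'a list"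
    assume "length ys = length (replicate p x @ c # replicate q x)"
    then have "m (drop j (drop (Suc p) ys) @ e # take i (take p ys)) = 0"
      using that by (intro unit_other) auto
    then show "bimod_term2 m \<phi> (replicate p 1) 0 (replicate q 1) 0
          (take p ys) (ys ! p) (drop (Suc p) ys) e i j = 0"
      by (simp add: bimod_term2_def \<phi>_dual_zero)
  qed
  let ?B = "{t \<in> {(p, q, i, j). i \<le> p \<and> j \<le> q}. (\<lambda>(p, q, i, j). (p - i, j)) t = PQ}"
  have "csums hsK T ?B (sum T {(P, Suc Q, 0, Q), (Suc P, Q, 1, Q)})"
  proof (rule sums.K.csums_finite_superset)
    fix t assume t: "t \<in> ?B - {(P, Suc Q, 0, Q), (Suc P, Q, 1, Q)}"
    obtain p q i j where pqij: "t = (p, q, i, j)" by (cases t)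
    have "q - j + i \<noteq> 1"
    proof
      assume "q - j + i = 1"
      then have "i = 0 \<and> q = Suc j \<or> i = 1 \<and> q = j" using t by (auto simp: pqij)
      then show False using t by (auto simp: pqij PQ)
    qed
    then show "T t = 0" using t T0 by (auto simp: pqij)
  qed (auto simp: PQ)
  moreover have "sum T {(P, Suc Q, 0, Q), (Suc P, Q, 1, Q)} = 0" using T1 T2 by simp
  ultimately show "csums hsK (\<lambda>(p, q, i, j). seq_ext
        (\<lambda>ys. bimod_term2 m \<phi> (replicate p 1) 0 (replicate q 1) 0
                (take p ys) (ys ! p) (drop (Suc p) ys) e i j)
        (replicate p x @ c # replicate q x) n) ?B 0"
    by (simp add: T_def)
qed

text \<open>For fixed (p, q) the terms of both families form one bimodule relation with
  \<open>w = I\<close>, so S1 + S2 = 0, and S2 = 0 by \<open>bimod_term2_unit_sum\<close>.\<close>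

lemma bimodule_relation_unit_sum:
  assumes x: "\<And>k. x k \<in> G 1" and c: "\<And>k. c k \<in> G 0"
    and S1: "csums hsK (\<lambda>(p, q, i, j). seq_ext
        (\<lambda>ys. bimod_term1 m \<phi> (replicate p 1) 0 (replicate q 1)
                (take p ys) (ys ! p) (drop (Suc p) ys) e i j)
        (replicate p x @ c # replicate q x) n)
      {(p, q, i, j). 1 \<le> j \<and> i + j \<le> p + q + 1} S1"
    and S2: "csums hsK (\<lambda>(p, q, i, j). seq_ext
        (\<lambda>ys. bimod_term2 m \<phi> (replicate p 1) 0 (replicate q 1) 0
                (take p ys) (ys ! p) (drop (Suc p) ys) e i j)
        (replicate p x @ c # replicate q x) n)
      {(p, q, i, j). i \<le> p \<and> j \<le> q} S2"
  shows "S1 = 0"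
proof -
  let ?u1 = "\<lambda>(p, q). \<Sum>(i, j)\<in>{(i, j). 1 \<le> j \<and> i + j \<le> p + q + 1}. seq_ext
        (\<lambda>ys. bimod_term1 m \<phi> (replicate p 1) 0 (replicate q 1)
                (take p ys) (ys ! p) (drop (Suc p) ys) e i j)
        (replicate p x @ c # replicate q x) n"
  let ?u2 = "\<lambda>(p, q). \<Sum>(i, j)\<in>{..p} \<times> {..q}. seq_ext
        (\<lambda>ys. bimod_term2 m \<phi> (replicate p 1) 0 (replicate q 1) 0
                (take p ys) (ys ! p) (drop (Suc p) ys) e i j)
        (replicate p x @ c # replicate q x) n"
  have u1: "csums hsK ?u1 UNIV S1"
  proof (rule sums.K.csums_regroup[OF S1, of "\<lambda>(p, q, i, j). (p, q)"])
    fix pq :: "nat \<times> nat"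
    obtain p q where pq: "pq = (p, q)" by (cases pq)
    have eq: "{t \<in> {(p, q, i, j). 1 \<le> j \<and> i + j \<le> p + q + 1}. (\<lambda>(p, q, i, j). (p, q)) t = pq}
        = (\<lambda>(i, j). (p, q, i, j)) ` {(i, j). 1 \<le> j \<and> i + j \<le> p + q + 1}"
      by (auto simp: pq)
    show "csums hsK (\<lambda>(p, q, i, j). seq_ext
        (\<lambda>ys. bimod_term1 m \<phi> (replicate p 1) 0 (replicate q 1)
                (take p ys) (ys ! p) (drop (Suc p) ys) e i j)
        (replicate p x @ c # replicate q x) n)
        {t \<in> {(p, q, i, j). 1 \<le> j \<and> i + j \<le> p + q + 1}. (\<lambda>(p, q, i, j). (p, q)) t = pq} (?u1 pq)"
      unfolding eq using sums.K.csums_finite[OF finite_subwords]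
      by (subst sums.K.csums_image) (auto simp: inj_on_def pq case_prod_unfold)
  qed simp
  have u2: "csums hsK ?u2 UNIV S2"
  proof (rule sums.K.csums_regroup[OF S2, of "\<lambda>(p, q, i, j). (p, q)"])
    fix pq :: "nat \<times> nat"
    obtain p q where pq: "pq = (p, q)" by (cases pq)
    have eq: "{t \<in> {(p, q, i, j). i \<le> p \<and> j \<le> q}. (\<lambda>(p, q, i, j). (p, q)) t = pq}
        = (\<lambda>(i, j). (p, q, i, j)) ` ({..p} \<times> {..q})"
      by (auto simp: pq)
    show "csums hsK (\<lambda>(p, q, i, j). seq_ext
        (\<lambda>ys. bimod_term2 m \<phi> (replicate p 1) 0 (replicate q 1) 0
                (take p ys) (ys ! p) (drop (Suc p) ys) e i j)
        (replicate p x @ c # replicate q x) n)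
        {t \<in> {(p, q, i, j). i \<le> p \<and> j \<le> q}. (\<lambda>(p, q, i, j). (p, q)) t = pq} (?u2 pq)"
      unfolding eq using sums.K.csums_finite[of "{..p} \<times> {..q}"]
      by (subst sums.K.csums_image) (auto simp: inj_on_def pq case_prod_unfold)
  qed simp
  have "?u1 pq + ?u2 pq = 0" for pq
  proof -
    obtain p q where pq: "pq = (p, q)" by (cases pq)
    have "seq_ext (\<lambda>ys. (\<Sum>(i, j)\<in>{(i, j). 1 \<le> j \<and> i + j \<le> p + q + 1}.
          bimod_term1 m \<phi> (replicate p 1) 0 (replicate q 1) (take p ys) (ys ! p) (drop (Suc p) ys) e i j)
        + (\<Sum>(i, j)\<in>{..p} \<times> {..q}.
          bimod_term2 m \<phi> (replicate p 1) 0 (replicate q 1) 0 (take p ys) (ys ! p) (drop (Suc p) ys) e i j))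
        (replicate p x @ c # replicate q x) n = seq_ext (\<lambda>_. 0) (replicate p x @ c # replicate q x) n"
    proof (rule seq_ext_cong_homogeneous[OF homogeneous_replicate_coeffs[of x G c 0, OF x c]])
      fix ys assume ys: "homogeneous G ys (replicate p 1 @ 0 # replicate q 1)"
      then have len: "length ys = p + q + 1" using homogeneous_length by fastforce
      have "homogeneous G (take p ys) (replicate p 1)" using homogeneous_take[OF ys, of p] by simp
      moreover have "ys ! p \<in> G 0" using homogeneous_nth[OF ys, of p] len by (simp add: nth_append)
      moreover have "homogeneous G (drop (Suc p) ys) (replicate q 1)"
        using homogeneous_drop[OF ys, of "Suc p"] by simp
      ultimately show "(\<Sum>(i, j)\<in>{(i, j). 1 \<le> j \<and> i + j \<le> p + q + 1}.
          bimod_term1 m \<phi> (replicate p 1) 0 (replicate q 1) (take p ys) (ys ! p) (drop (Suc p) ys) e i j)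
        + (\<Sum>(i, j)\<in>{..p} \<times> {..q}.
          bimod_term2 m \<phi> (replicate p 1) 0 (replicate q 1) 0 (take p ys) (ys ! p) (drop (Suc p) ys) e i j) = 0"
        using bimodule_relation[OF _ _ _ unit_degree, of "take p ys" "replicate p 1" "ys ! p" 0
            "drop (Suc p) ys" "replicate q 1"] len by simp
    qed
    then show ?thesis by (simp add: pq seq_ext_add seq_ext_sum seq_ext_0 case_prod_unfold)
  qed
  then have "S1 + S2 = 0"
    using sums.K.csums_add[OF u1 u2] sums.K.csums_0 sums.K.csums_unique by (metis (no_types, lifting) ext)
  moreover have "S2 = 0" by (rule bimod_term2_unit_sum[OF x c S2])
  ultimately show ?thesis by simp
qed

section \<open>The Maurer-Cartan equation along a gauge path\<close>

lemma peval_0: "peval sc x 0 = coeff x 0"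
proof -
  have "(\<Sum>n\<in>{..degree x} - {0}. sc (0 ^ n) (coeff x n)) = 0" by (rule sum.neutral) simp
  then show ?thesis unfolding peval_def by (subst sum.remove[of _ 0]) auto
qed

text \<open>Induction over the power of t: the coefficient at t^(k+1) is 1/(k+1) times that of the
  derivative at t^k, for which \<open>csums_insert_gauge\<close> asks for the Maurer-Cartan equation
  only up to t^k.\<close>

lemma maurer_cartan_coeffs:
  assumes path: "gauge_path sc G m hsA x c" and start: "peval sc x 0 \<in> maurer_cartan G m hsA"
    and sums: "sums_make_sense sc m e \<phi> hsA hsK x c"
  shows "csums hsA (\<lambda>j. seq_ext m (replicate j (coeff x)) n) {1..} 0"
proof (induction n rule: less_induct)
  case (less n)
  note gauge = path[unfolded gauge_path_def poly_in_def poly_ext_eq_seq_ext]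
  show ?case
  proof (cases n)
    case 0
    then show ?thesis
      using start by (simp add: maurer_cartan_def seq_ext_coeff_0 peval_0)
  next
    case (Suc k)
    let ?T = "\<lambda>(p, q, i, j). seq_ext
        (\<lambda>ys. sc ((-1) powi sdeg (take i (replicate p 1 @ 0 # replicate q 1)))
          (m (take i ys @ m (take j (drop i ys)) # drop (i + j) ys)))
        (replicate p (coeff x) @ coeff c # replicate q (coeff x)) k"
    let ?y = "\<lambda>k. sc (of_nat (Suc k)) (coeff x (Suc k))"
    obtain S where S: "csums hsA ?T {(p, q, i, j). 1 \<le> j \<and> i + j \<le> p + q + 1} S"
      using sums unfolding sums_make_sense_def poly_ext_eq_seq_ext
      by (auto dest!: sums.A.tsummable_coeff[where n = k]
          simp: ainf_term_def case_prod_unfold map_replicate_const)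
    have "csums hsA (\<lambda>(p, q). seq_ext m (replicate p (coeff x) @ ?y # replicate q (coeff x)) k) UNIV S"
    proof (rule sums.A.csums_insert_gauge[OF m_multilinear sums.insert_m S])
      show "csums hsA (\<lambda>j. seq_ext m (replicate j (coeff x)) l) {1..} 0" if "l \<le> k" for l
        using less that Suc by simp
      show "csums hsA (\<lambda>(r, s). seq_ext m (replicate r (coeff x) @ coeff c # replicate s (coeff x)) l) UNIV (?y l)"
        for l using gauge by simp
    qed
    \<comment> \<open>Grouped by (p, q), the terms form complete A-infinity relations.\<close>
    moreover have "S = 0"
    proof (rule sums.A.csums_zero_blocks[OF S, of "\<lambda>(p, q, i, j). (p, q)"])
      fix pq :: "nat \<times> nat"
      obtain p q where pq: "pq = (p, q)" by (cases pq)
      let ?ss = "replicate p (coeff x) @ coeff c # replicate q (coeff x)"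
      have "seq_ext (\<lambda>ys. \<Sum>(i, j)\<in>{(i, j). 1 \<le> j \<and> i + j \<le> p + q + 1}.
          ainf_term sc m (replicate p 1 @ 0 # replicate q 1) ys i j) ?ss k = seq_ext (\<lambda>_. 0) ?ss k"
      proof (rule seq_ext_cong_homogeneous)
        show "list_all2 (\<lambda>s d. \<forall>k. s k \<in> G d) ?ss (replicate p 1 @ 0 # replicate q 1)"
          by (rule homogeneous_replicate_coeffs) (use gauge in auto)
        fix ys assume ys: "homogeneous G ys (replicate p 1 @ 0 # replicate q 1)"
        then have "length ys = p + q + 1" using homogeneous_length by fastforce
        then show "(\<Sum>(i, j)\<in>{(i, j). 1 \<le> j \<and> i + j \<le> p + q + 1}.
          ainf_term sc m (replicate p 1 @ 0 # replicate q 1) ys i j) = 0"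
          using a_infinity_relation[OF ys] by simp
      qed
      then have *: "(\<Sum>(i, j)\<in>{(i, j). 1 \<le> j \<and> i + j \<le> p + q + 1}. ?T (p, q, i, j)) = 0"
        by (simp add: seq_ext_sum seq_ext_0 case_prod_unfold ainf_term_def)
      have eq: "{t \<in> {(p, q, i, j). 1 \<le> j \<and> i + j \<le> p + q + 1}. (\<lambda>(p, q, i, j). (p, q)) t = pq}
          = (\<lambda>(i, j). (p, q, i, j)) ` {(i, j). 1 \<le> j \<and> i + j \<le> p + q + 1}"
        by (auto simp: pq)
      have "csums hsA (\<lambda>(i, j). ?T (p, q, i, j)) {(i, j). 1 \<le> j \<and> i + j \<le> p + q + 1} 0"
        using sums.A.csums_finite[OF finite_subwords[of "p + q + 1"], of "\<lambda>(i, j). ?T (p, q, i, j)"]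
        by (simp only: *)
      then show "csums hsA ?T
          {t \<in> {(p, q, i, j). 1 \<le> j \<and> i + j \<le> p + q + 1}. (\<lambda>(p, q, i, j). (p, q)) t = pq} 0"
        unfolding eq by (subst sums.A.csums_image) (auto simp: inj_on_def case_prod_unfold)
    qed
    ultimately have D: "csums hsA (\<lambda>(p, q). seq_ext m (replicate p (coeff x) @ ?y # replicate q (coeff x)) k) UNIV 0"
      by simp
    \<comment> \<open>By the Leibniz rule, the words of length j with one entry differentiated give
      the derivative of m_j(x,...,x).\<close>
    have "csums hsA (\<lambda>j. sc (of_nat (Suc k)) (seq_ext m (replicate j (coeff x)) (Suc k))) {1..} 0"
    proof (rule sums.A.csums_regroup[OF D, of "\<lambda>(p, q). Suc (p + q)"])
      fix j :: nat assume "j \<in> {1..}"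
      then obtain N where N: "j = Suc N" by (cases j) auto
      have "{pq \<in> UNIV. (\<lambda>(p, q). Suc (p + q)) pq = j} = {(p, q). p + q = N}" by (auto simp: N)
      then show "csums hsA (\<lambda>(p, q). seq_ext m (replicate p (coeff x) @ ?y # replicate q (coeff x)) k)
          {pq \<in> UNIV. (\<lambda>(p, q). Suc (p + q)) pq = j}
          (sc (of_nat (Suc k)) (seq_ext m (replicate j (coeff x)) (Suc k)))"
        using sums.A.csums_derivative[OF m_multilinear refl, of "coeff x" k N] by (simp only: N)
    qed auto
    \<comment> \<open>Division by k + 1 uses characteristic 0.\<close>
    from sums.A.csums_scale[OF this, of "inverse (of_nat (Suc k))"]
    show ?thesis by (simp add: Suc del: of_nat_Suc)
  qed
qed

section \<open>The series \<Psi>(x(t)) and its derivative\<close>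

text \<open>With the bimodule entry moved to the front, only p + q matters; the p + q + 1 pairs with
  the same sum will cancel the factor.\<close>

lemma Psi_path_term_eq:
  assumes x: "\<And>n. coeff x n \<in> G 1"
  shows "Psi_path_term \<phi> e x (p, q) n
    = 1 / of_nat (Suc (p + q)) * seq_ext unit_pairing (replicate (Suc (p + q)) (coeff x)) n"
proof -
  have "seq_ext (\<lambda>ys. \<phi> (take p ys) (ys ! p) (drop (Suc p) ys) e) (replicate p (coeff x) @ coeff x # replicate q (coeff x)) n
      = seq_ext unit_pairing (replicate p (coeff x) @ coeff x # replicate q (coeff x)) n"
  proof (rule seq_ext_cong_homogeneous)
    show "list_all2 (\<lambda>s d. \<forall>k. s k \<in> G d) (replicate p (coeff x) @ coeff x # replicate q (coeff x))
        (replicate p 1 @ 1 # replicate q 1)"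
      by (rule homogeneous_replicate_coeffs) (use x in auto)
    fix ys assume ys: "homogeneous G ys (replicate p 1 @ 1 # replicate q 1)"
    then show "\<phi> (take p ys) (ys ! p) (drop (Suc p) ys) e = unit_pairing ys"
      using homogeneous_length[OF ys] by (intro \<phi>_unit_split) auto
  qed
  moreover have "replicate p (coeff x) @ coeff x # replicate q (coeff x) = replicate (Suc (p + q)) (coeff x)"
    by (simp add: replicate_add replicate_app_Cons_same)
  ultimately show ?thesis by (simp only: Psi_path_term_def prod.case poly_ext_eq_seq_ext map_append
        list.map map_replicate) simp
qed

text \<open>Existence from \<open>tsummable\<close> and uniqueness of sums make the
  \<open>THE\<close> in \<open>Psi_path\<close> the actual sum.\<close>

lemma Psi_path_nth:
  assumes "tsummable hsK (Psi_path_term \<phi> e x) UNIV"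
  shows "csums hsK (\<lambda>pq. Psi_path_term \<phi> e x pq n) UNIV (fps_nth (Psi_path \<phi> e hsK x) n)"
proof -
  obtain s where s: "csums hsK (\<lambda>pq. Psi_path_term \<phi> e x pq n) UNIV s"
    using sums.K.tsummable_coeff[OF assms] by blast
  then have "(THE s. csums hsK (\<lambda>pq. Psi_path_term \<phi> e x pq n) UNIV s) = s"
    using sums.K.csums_unique by blast
  then show ?thesis using s by (simp add: Psi_path_def)
qed

lemma Psi_path_derivative:
  assumes path: "gauge_path sc G m hsA x c" and start: "peval sc x 0 \<in> maurer_cartan G m hsA"
    and sums: "sums_make_sense sc m e \<phi> hsA hsK x c"
  shows "fps_deriv (Psi_path \<phi> e hsK x) = 0"
proof (rule fps_ext)
  fix n
  let ?X = "coeff x"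
  let ?y = "\<lambda>k. sc (of_nat (Suc k)) (coeff x (Suc k))"
  let ?N = "{(p :: nat, q :: nat, i :: nat, j :: nat). 1 \<le> j \<and> i + j \<le> p + q + 1}"
  note gauge = path[unfolded gauge_path_def poly_in_def poly_ext_eq_seq_ext]
  have x: "coeff x k \<in> G 1" and c: "coeff c k \<in> G 0" for k using gauge by auto
  let ?T1 = "\<lambda>(p, q, i, j). seq_ext
        (\<lambda>ys. bimod_term1 m \<phi> (replicate p 1) 0 (replicate q 1)
                (take p ys) (ys ! p) (drop (Suc p) ys) e i j)
        (replicate p ?X @ coeff c # replicate q ?X) n"
  obtain S1 where S1: "csums hsK ?T1 ?N S1"
    using sums unfolding sums_make_sense_def poly_ext_eq_seq_ext
    by (auto dest!: sums.K.tsummable_coeff[where n = n] simp: case_prod_unfold map_replicate_const)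
  obtain S2 where S2: "csums hsK (\<lambda>(p, q, i, j). seq_ext
        (\<lambda>ys. bimod_term2 m \<phi> (replicate p 1) 0 (replicate q 1) 0
                (take p ys) (ys ! p) (drop (Suc p) ys) e i j)
        (replicate p ?X @ coeff c # replicate q ?X) n)
      {(p, q, i, j). i \<le> p \<and> j \<le> q} S2"
    using sums unfolding sums_make_sense_def poly_ext_eq_seq_ext
    by (auto dest!: sums.K.tsummable_coeff[where n = n] simp: case_prod_unfold map_replicate_const)
  have "S1 = 0" by (rule bimodule_relation_unit_sum[OF x c S1 S2])
  have total: "csums hsK (\<lambda>(p, q, i, j). seq_ext
        (\<lambda>ys. (-1) powi sdeg (take i (replicate p 1 @ 0 # replicate q 1)) *
          unit_pairing (take i ys @ m (take j (drop i ys)) # drop (i + j) ys))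
        (replicate p ?X @ coeff c # replicate q ?X) n) ?N S1"
  proof (rule sums.K.csums_cong[OF S1])
    fix t assume "t \<in> ?N"
    then obtain p q i j where t: "t = (p, q, i, j)" "1 \<le> j" "i + j \<le> p + q + 1" by auto
    show "?T1 t = (\<lambda>(p, q, i, j). seq_ext
        (\<lambda>ys. (-1) powi sdeg (take i (replicate p 1 @ 0 # replicate q 1)) *
          unit_pairing (take i ys @ m (take j (drop i ys)) # drop (i + j) ys))
        (replicate p ?X @ coeff c # replicate q ?X) n) t"
      unfolding t(1) prod.case
      by (rule seq_ext_cong_homogeneous[OF homogeneous_replicate_coeffs[of ?X G "coeff c" 0, OF x c]])
        (rule bimod_term1_unit[OF _ t(2,3)])
  qed
  \<comment> \<open>The gauge equation turns the first sum of the bimodule relations into the sum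
    with x'(t) inserted.\<close>
  have "csums hsK (\<lambda>(p, q). seq_ext unit_pairing (replicate p ?X @ ?y # replicate q ?X) n) UNIV S1"
  proof (rule sums.K.csums_insert_gauge[OF multilinear_unit_pairing insert_unit_pairing total])
    show "csums hsA (\<lambda>j. seq_ext m (replicate j ?X) k) {1..} 0" for k
      by (rule maurer_cartan_coeffs[OF assms])
    show "csums hsA (\<lambda>(r, s). seq_ext m (replicate r ?X @ coeff c # replicate s ?X) k) UNIV (?y k)" for k
      using gauge by simp
  qed
  then have D: "csums hsK (\<lambda>(p, q). seq_ext unit_pairing (replicate p ?X @ ?y # replicate q ?X) n) UNIV 0"
    using \<open>S1 = 0\<close> by simp
  let ?u = "\<lambda>N. seq_ext unit_pairing (replicate (Suc N) ?X) (Suc n)"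
  have diag: "{pq \<in> UNIV. (\<lambda>(p, q). p + q) pq = N} = {(p, q). p + q = N}" for N :: nat by auto
  have 1: "csums hsK (\<lambda>N. of_nat (Suc n) * ?u N) UNIV 0"
  proof (rule sums.K.csums_regroup[OF D, of "\<lambda>(p, q). p + q"])
    fix N
    show "csums hsK (\<lambda>(p, q). seq_ext unit_pairing (replicate p ?X @ ?y # replicate q ?X) n)
        {pq \<in> UNIV. (\<lambda>(p, q). p + q) pq = N} (of_nat (Suc n) * ?u N)"
      unfolding diag by (rule sums.K.csums_derivative[OF multilinear_unit_pairing refl])
  qed simp
  have T: "tsummable hsK (Psi_path_term \<phi> e x) UNIV" using sums by (simp add: sums_make_sense_def)
  \<comment> \<open>The N + 1 pairs with p + q = N contribute equal terms of weight 1/(N +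
    1).\<close>
  have 2: "csums hsK ?u UNIV (fps_nth (Psi_path \<phi> e hsK x) (Suc n))"
  proof (rule sums.K.csums_regroup[OF Psi_path_nth[OF T], of "\<lambda>(p, q). p + q"])
    fix N
    have card: "card {(p, q). p + q = N} = Suc N"
      unfolding antidiagonal_eq by (subst card_image) (auto simp: inj_on_def)
    have "(\<Sum>pq\<in>{(p, q). p + q = N}. Psi_path_term \<phi> e x pq (Suc n))
        = (\<Sum>pq\<in>{(p, q). p + q = N}. 1 / of_nat (Suc N) * ?u N)"
      by (rule sum.cong) (auto simp: Psi_path_term_eq[OF x] simp del: replicate_Suc seq_ext.simps)
    also have "\<dots> = ?u N"
      by (simp only: sum_constant card) (simp del: replicate_Suc of_nat_Suc seq_ext.simps)
    finally have *: "(\<Sum>pq\<in>{(p, q). p + q = N}. Psi_path_term \<phi> e x pq (Suc n)) = ?u N" .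
    have "finite {(p, q). p + q = N}" unfolding antidiagonal_eq by simp
    from sums.K.csums_finite[OF this, of "\<lambda>pq. Psi_path_term \<phi> e x pq (Suc n)"]
    show "csums hsK (\<lambda>pq. Psi_path_term \<phi> e x pq (Suc n))
        {pq \<in> UNIV. (\<lambda>(p, q). p + q) pq = N} (?u N)"
      unfolding diag * .
  qed simp
  \<comment> \<open>After scaling \<open>2\<close> by n + 1, both facts sum the same family.\<close>
  have "of_nat (Suc n) * fps_nth (Psi_path \<phi> e hsK x) (Suc n) = 0"
    using sums.K.csums_unique[OF sums.K.csums_scale[OF 2] 1] .
  then show "fps_nth (fps_deriv (Psi_path \<phi> e hsK x)) n = fps_nth 0 n"
    by (simp add: Suc_eq_plus1[symmetric] del: Suc_eq_plus1 of_nat_Suc)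
qed

section \<open>Values of \<Psi> at the ends of a path\<close>

lemma Psi_eq:
  assumes x: "x \<in> G 1"
    and s: "csums hsK (\<lambda>(p, q). 1 / of_nat (Suc (p + q)) * unit_pairing (replicate (Suc (p + q)) x)) UNIV s"
  shows "Psi \<phi> e hsK x = s"
proof -
  have "\<phi> (replicate p x) x (replicate q x) e = unit_pairing (replicate (Suc (p + q)) x)" for p q
  proof -
    have "homogeneous G (replicate p x @ x # replicate q x) (replicate (Suc (p + q)) 1)"
      using x by (simp add: homogeneous_def list_all2_conv_all_nth nth_append nth_Cons' del: replicate_Suc)
    from \<phi>_unit_position[OF this] show ?thesis
      by (simp add: replicate_add replicate_app_Cons_same)
  qed
  then show ?thesis
    using s unfolding Psi_def by (auto intro!: the_equality elim: sums.K.csums_unique simp del: replicate_Suc)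
qed

text \<open>Summing all coefficients over the powers of t first gives \<Psi>(x(1)); summing over (p,
  q) first leaves the constant coefficient \<Psi>(x(0)), because the derivative vanishes.\<close>

lemma Psi_gauge_equivalent:
  assumes path: "gauge_path sc G m hsA x c" and start: "peval sc x 0 \<in> maurer_cartan G m hsA"
    and sums: "sums_make_sense sc m e \<phi> hsA hsK x c"
  shows "Psi \<phi> e hsK (peval sc x 0) = Psi \<phi> e hsK (peval sc x 1)"
proof -
  have x: "coeff x k \<in> G 1" for k using path by (auto simp: gauge_path_def poly_in_def)
  let ?P = "fps_nth (Psi_path \<phi> e hsK x)"
  have T: "tsummable hsK (Psi_path_term \<phi> e x) UNIV" using sums by (simp add: sums_make_sense_def)
  note nth = Psi_path_nth[OF T]
  have eval_1: "peval sc x 1 = (\<Sum>k\<le>degree x. coeff x k)" by (simp add: peval_def)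
  have in_G: "peval sc x 1 \<in> G 1" unfolding eval_1 using x by (intro subspace_sum graded_subspace)
  have Psi_0: "Psi \<phi> e hsK (peval sc x 0) = ?P 0"
    using nth[of 0] by (intro Psi_eq)
      (auto simp: peval_0 x Psi_path_term_eq[OF x] seq_ext_coeff_0 case_prod_unfold
        simp del: replicate_Suc elim: sums.K.csums_cong)
  \<comment> \<open>Here the joint summability over (p, q) and the powers of t enters.\<close>
  obtain s where s: "csums hsK (\<lambda>(pq, n). Psi_path_term \<phi> e x pq n) (UNIV \<times> UNIV) s"
    using T by (auto simp: tsummable_def)
  \<comment> \<open>The fibre over (p, q) consists of the coefficients of one polynomial, whose sum
    is its value at t = 1.\<close>
  have "csums hsK (\<lambda>(p, q). 1 / of_nat (Suc (p + q)) * unit_pairing (replicate (Suc (p + q)) (peval sc x 1))) UNIV s"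
  proof (rule sums.K.csums_regroup[OF s, of fst])
    fix pq :: "nat \<times> nat"
    obtain p q where pq: "pq = (p, q)" by (cases pq)
    have eq: "{t \<in> UNIV \<times> UNIV. fst t = pq} = Pair pq ` UNIV" by auto
    have "csums hsK (seq_ext unit_pairing (replicate (Suc (p + q)) (coeff x))) UNIV
        (unit_pairing (map (\<lambda>s. \<Sum>k\<le>degree x. s k) (replicate (Suc (p + q)) (coeff x))))"
      by (rule sums.K.seq_ext_total_csums[OF multilinear_unit_pairing]) (auto intro: coeff_eq_0)
    then have "csums hsK (seq_ext unit_pairing (replicate (Suc (p + q)) (coeff x))) UNIV
        (unit_pairing (replicate (Suc (p + q)) (peval sc x 1)))"
      by (simp add: eval_1 del: replicate_Suc)
    from sums.K.csums_scale[OF this, of "1 / of_nat (Suc (p + q))"]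
    show "csums hsK (\<lambda>(pq, n). Psi_path_term \<phi> e x pq n) {t \<in> UNIV \<times> UNIV. fst t = pq}
        ((\<lambda>(p, q). 1 / of_nat (Suc (p + q)) * unit_pairing (replicate (Suc (p + q)) (peval sc x 1))) pq)"
      unfolding eq by (subst sums.K.csums_image) (auto simp: pq Psi_path_term_eq[OF x] inj_on_def simp del: replicate_Suc)
  qed simp
  then have Psi_1: "Psi \<phi> e hsK (peval sc x 1) = s" by (rule Psi_eq[OF in_G])
  have P_sum: "csums hsK ?P UNIV s"
  proof (rule sums.K.csums_regroup[OF s, of snd])
    fix n :: nat
    have eq: "{t \<in> UNIV \<times> UNIV. snd t = n} = (\<lambda>pq. (pq, n)) ` UNIV" by auto
    show "csums hsK (\<lambda>(pq, n). Psi_path_term \<phi> e x pq n) {t \<in> UNIV \<times> UNIV. snd t = n} (?P n)"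
      unfolding eq using nth[of n] by (subst sums.K.csums_image) (auto simp: inj_on_def)
  qed simp
  have Suc: "?P (Suc n) = 0" for n
    using arg_cong[OF Psi_path_derivative[OF assms], of "\<lambda>F. fps_nth F n"]
    by (simp add: Suc_eq_plus1[symmetric] del: Suc_eq_plus1 of_nat_Suc)
  have "?P n = 0" if "n \<in> UNIV - {0}" for n
    using that Suc by (cases n) auto
  then have "csums hsK ?P UNIV (sum ?P {0})"
    by (intro sums.K.csums_finite_superset) auto
  then have "csums hsK ?P UNIV (?P 0)" by simp
  with P_sum have "s = ?P 0" by (rule sums.K.csums_unique)
  then show ?thesis using Psi_0 Psi_1 by simp
qed

end

section \<open>Gauge invariance of \<Psi>\<close>

theorem proposition4p1:
  fixes sc :: "'k::field_char_0 \<Rightarrow> 'a::ab_group_add \<Rightarrow> 'a"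
    and G :: "int \<Rightarrow> 'a set"
    and m :: "'a list \<Rightarrow> 'a"
    and e :: 'a
    and \<phi> :: "'a list \<Rightarrow> 'a \<Rightarrow> 'a list \<Rightarrow> 'a \<Rightarrow> 'k"
    and hsA :: "(nat \<Rightarrow> 'a) \<Rightarrow> nat set \<Rightarrow> 'a \<Rightarrow> bool"
    and hsK :: "(nat \<Rightarrow> 'k) \<Rightarrow> nat set \<Rightarrow> 'k \<Rightarrow> bool"
  assumes algebra: "unital_a_infinity_algebra sc G m e"
    and inner_product: "strong_homotopy_inner_product sc G m \<phi>"
    and unital: "unital_bimodule_map sc e \<phi>"
    and summation: "summation_in_operations sc hsA hsK m \<phi>"
    and sums: "\<And>x c. gauge_path sc G m hsA x c \<Longrightarrow> peval sc x 0 \<in> maurer_cartan G m hsA \<Longrightarrow>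
                 sums_make_sense sc m e \<phi> hsA hsK x c"
  shows "(\<forall>b b'. gauge_equivalent sc G m hsA b b' \<longrightarrow> Psi \<phi> e hsK b = Psi \<phi> e hsK b') \<and>
         (\<forall>x c. gauge_path sc G m hsA x c \<and> (\<forall>t. peval sc x t \<in> maurer_cartan G m hsA) \<longrightarrow>
            fps_deriv (Psi_path \<phi> e hsK x) = 0)"
proof -
  interpret gauge_setting sc G m e \<phi> hsA hsK
    by (intro gauge_setting.intro gauge_setting_axioms.intro algebra inner_product summation unital)
  \<comment> \<open>x(0) is Maurer-Cartan: it is \<open>b\<close> in the first conjunct, and the
    instance t = 0 of the hypothesis in the second.\<close>
  show ?thesis
    using Psi_gauge_equivalent Psi_path_derivative sums by (auto simp: gauge_equivalent_def)
qed

end
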